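(* In the network setting of the context, suppose the vector $\gamma=(\gamma_1,\dots,\gamma_I)$ is not identically zero. Then there exists a constant control $\bar u=(\bar u^c,\bar u^s)\in\mathbb U$ with the following property: for every $m\ge1$ there exist a diagonal matrix $Q$ with positive diagonal entries, a function $\mathcal V\in C^2(\mathbb R^I)$ with $\mathcal V(x)=(x^{\mathsf T}Qx)^{m/2}$ for $|x|\ge1$, and constants $\kappa_0,\kappa_1>0$ such that $$\mathcal L^{\bar u}\mathcal V(x)\le\kappa_0-\kappa_1\mathcal V(x)\qquad\forall x\in\mathbb R^I.$$ Consequently the diffusion under $\bar u$ is geometrically ergodic and its invariant probability distribution has finite moments of all orders.
   Context: Network setting. $\mathcal I=\{1,\dots,I\}$, $\mathcal J=\{1,\dots,J\}$; $\mathcal G$ a bipartite tree on $\mathcal I\cup\mathcal J$ with edges $i\sim j$; $\mathcal J(i)=\{j:i\sim j\}$. Constants $\lambda_i>0$, $\gamma_i\ge0$, $\ell_i\in\mathbb R$; $\mu_{ij}>0$ if $i\sim j$, $\mu_{ij}=0$ otherwise. $e$ = all-ones vector, $a^\pm$ positive/negative parts. For $e\cdot\alpha=e\cdot\beta$, $G(\alpha,\beta)$ is the unique $\psi\in\mathbb R^{I\times J}$ with row sums $\alpha_i$, column sums $\beta_j$, and $\psi_{ij}=0$ for $i\not\sim j$. $\mathbb U=\{u=(u^c,u^s)\in\mathbb R^I_+\times\mathbb R^J_+:e\cdot u^c=e\cdot u^s=1\}$; $\hat G[u](x)=G(x-(e\cdot x)^+u^c,-(e\cdot x)^-u^s)$;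 drift $b_i(x,u)=-\sum_{j\in\mathcal J(i)}\mu_{ij}\hat G_{ij}[u](x)-\gamma_i(e\cdot x)^+u^c_i+\ell_i$. Controlled diffusion $dX_t=b(X_t,U_t)dt+\Sigma dW_t$ with $\Sigma=\operatorname{diag}(\sqrt{2\lambda_i})$; controlled generator $\mathcal L^u f(x)=\sum_i\lambda_i\partial_{ii}f(x)+b(x,u)\cdot\nabla f(x)$. A constant control $\bar u\in\mathbb U$ means $U_t\equiv\bar u$. *)

theory Defs
  imports "HOL-Analysis.Analysis"
begin

fun badj :: "('i \<Rightarrow> 'j \<Rightarrow> bool) \<Rightarrow> 'i + 'j \<Rightarrow> 'i + 'j \<Rightarrow> bool" where
  "badj E (Inl i) (Inr j) = E i j"
| "badj E (Inr j) (Inl i) = E i j"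
| "badj E _ _ = False"

definition is_walk :: "('i \<Rightarrow> 'j \<Rightarrow> bool) \<Rightarrow> ('i + 'j) list \<Rightarrow> bool" where
  "is_walk E vs \<longleftrightarrow> (\<forall>k. Suc k < length vs \<longrightarrow> badj E (vs ! k) (vs ! Suc k))"

definition bconnected :: "('i \<Rightarrow> 'j \<Rightarrow> bool) \<Rightarrow> bool" where
  "bconnected E \<longleftrightarrow> (\<forall>v w. \<exists>vs. vs \<noteq> [] \<and> hd vs = v \<and> last vs = w \<and> is_walk E vs)"

definition has_cycle :: "('i \<Rightarrow> 'j \<Rightarrow> bool) \<Rightarrow> bool" where
  "has_cycle E \<longleftrightarrow> (\<exists>vs. 3 \<le> length vs \<and> distinct vs \<and> is_walk E vs \<and> badj E (last vs) (hd vs))"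

definition bip_tree :: "('i \<Rightarrow> 'j \<Rightarrow> bool) \<Rightarrow> bool" where
  "bip_tree E \<longleftrightarrow> bconnected E \<and> \<not> has_cycle E"

definition ppart :: "real \<Rightarrow> real" where "ppart a = max a 0"
definition npart :: "real \<Rightarrow> real" where "npart a = max (- a) 0"

definition esum :: "real^'i \<Rightarrow> real" where "esum x = (\<Sum>i\<in>UNIV. x $ i)"

definition Gmat :: "('i::finite \<Rightarrow> 'j::finite \<Rightarrow> bool) \<Rightarrow> ('i \<Rightarrow> real) \<Rightarrow> ('j \<Rightarrow> real)
    \<Rightarrow> ('i \<Rightarrow> 'j \<Rightarrow> real)" where
  "Gmat E \<alpha> \<beta> = (THE \<psi>. (\<forall>i. (\<Sum>j\<in>UNIV. \<psi> i j) = \<alpha> i) \<and> (\<forall>j. (\<Sum>i\<in>UNIV. \<psi> i j) = \<beta> j)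
                        \<and> (\<forall>i j. \<not> E i j \<longrightarrow> \<psi> i j = 0))"

definition Uset :: "(('i::finite \<Rightarrow> real) \<times> ('j::finite \<Rightarrow> real)) set" where
  "Uset = {(uc, us). (\<forall>i. 0 \<le> uc i) \<and> (\<forall>j. 0 \<le> us j) \<and> sum uc UNIV = 1 \<and> sum us UNIV = 1}"

definition Ghat :: "('i::finite \<Rightarrow> 'j::finite \<Rightarrow> bool) \<Rightarrow> ('i \<Rightarrow> real) \<times> ('j \<Rightarrow> real)
    \<Rightarrow> real^'i \<Rightarrow> ('i \<Rightarrow> 'j \<Rightarrow> real)" where
  "Ghat E u x = Gmat E (\<lambda>i. x $ i - ppart (esum x) * fst u i) (\<lambda>j. - npart (esum x) * snd u j)"

definition drift :: "('i::finite \<Rightarrow> 'j::finite \<Rightarrow> bool) \<Rightarrow> ('i \<Rightarrow> 'j \<Rightarrow> real) \<Rightarrow> ('i \<Rightarrow> real)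
    \<Rightarrow> ('i \<Rightarrow> real) \<Rightarrow> real^'i \<Rightarrow> ('i \<Rightarrow> real) \<times> ('j \<Rightarrow> real) \<Rightarrow> real^'i" where
  "drift E \<mu> \<gamma> ell x u = (\<chi> i. - (\<Sum>j\<in>{j. E i j}. \<mu> i j * Ghat E u x i j)
                              - \<gamma> i * ppart (esum x) * fst u i + ell i)"

definition C2 :: "(real^'i::finite \<Rightarrow> real) \<Rightarrow> bool" where
  "C2 f \<longleftrightarrow> (\<exists>(f' :: real^'i \<Rightarrow> ((real^'i) \<Rightarrow>\<^sub>L real))
                 (f'' :: real^'i \<Rightarrow> ((real^'i) \<Rightarrow>\<^sub>L ((real^'i) \<Rightarrow>\<^sub>L real))).
        (\<forall>x. (f has_derivative blinfun_apply (f' x)) (at x)) \<and>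
        (\<forall>x. (f' has_derivative blinfun_apply (f'' x)) (at x)) \<and>
        continuous_on UNIV f'')"

definition partial :: "'i::finite \<Rightarrow> (real^'i \<Rightarrow> real) \<Rightarrow> real^'i \<Rightarrow> real" where
  "partial i f x = deriv (\<lambda>t. f (x + t *\<^sub>R axis i 1)) 0"

definition generator :: "('i::finite \<Rightarrow> 'j::finite \<Rightarrow> bool) \<Rightarrow> ('i \<Rightarrow> 'j \<Rightarrow> real) \<Rightarrow> ('i \<Rightarrow> real)
    \<Rightarrow> ('i \<Rightarrow> real) \<Rightarrow> ('i \<Rightarrow> real) \<Rightarrow> ('i \<Rightarrow> real) \<times> ('j \<Rightarrow> real)
    \<Rightarrow> (real^'i \<Rightarrow> real) \<Rightarrow> real^'i \<Rightarrow> real" where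
  "generator E \<mu> lam \<gamma> ell u f x =
     (\<Sum>i\<in>UNIV. lam i * partial i (partial i f) x)
     + (\<Sum>i\<in>UNIV. drift E \<mu> \<gamma> ell x u $ i * partial i f x)"

end

(*
  Root the tree at a pool adjacent to a class k with positive abandonment rate, and let the
  constant control queue all excess work at k and leave only the root pool idle (vertices of I
  are customer classes, those of J server pools). On a tree G(alpha, beta) is explicit: the
  edge from a vertex to its parent carries the net surplus of the subtree below the vertex.
  Hence the drift of class i is -mu(i, parent i) x_i plus a combination of the classes below i,
  except at k, where abandonment replaces service and couples x_k to the total e.x. With k
  ranked first and the other classes ranked by depth the drift is triangular with a negative
  diagonal, and geometric weights q_i = rho^(rank i) give sum_i q_i x_i b_i(x) <= L|x| - c|x|^2.
  For V = (x' Q x)^(m/2) with Q = diag q, smoothed inside the unit ball, the generator is then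
  at most -kappa_1 V far from the origin and bounded on compact sets.
*)

theory Submission
  imports Defs
begin

section \<open>Rooted bipartite trees and the flows they carry\<close>

lemma badj_sym: "badj E v w = badj E w v"
  by (cases v; cases w) auto

lemma badj_cases [elim]:
  assumes "badj E v w"
  obtains i j where "v = Inl i" "w = Inr j" "E i j" | i j where "v = Inr j" "w = Inl i" "E i j"
  using assms by (cases v; cases w) auto

lemma sum_UNIV_sum_type:
  fixes f :: "'a::finite + 'b::finite \<Rightarrow> 'c::comm_monoid_add"
  shows "(\<Sum>u\<in>UNIV. f u) = (\<Sum>a\<in>UNIV. f (Inl a)) + (\<Sum>b\<in>UNIV. f (Inr b))"
  by (simp flip: UNIV_Plus_UNIV add: sum.Plus comp_def)

lemma is_walk_iff_successively: "is_walk E vs \<longleftrightarrow> successively (badj E) vs"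
  unfolding is_walk_def successively_conv_nth ..

lemma bip_tree_has_neighbour:
  assumes "bip_tree E"
  obtains j where "E i j"
proof -
  obtain vs where vs: "vs \<noteq> []" "hd vs = Inl i" "last vs = Inr undefined" "is_walk E vs"
    using assms unfolding bip_tree_def bconnected_def by blast
  then obtain w vs' where "vs = Inl i # w # vs'" by (metis hd_Cons_tl last_ConsL sum.distinct(1) list.collapse)
  then have "badj E (Inl i) w" using vs(4) unfolding is_walk_iff_successively by simp
  then show ?thesis using that by (elim badj_cases) auto
qed

locale rooted_bip_tree =
  fixes E :: "'i::finite \<Rightarrow> 'j::finite \<Rightarrow> bool" and root :: 'j
  assumes tree: "bip_tree E"
begin

fun reachable_in :: "nat \<Rightarrow> 'i + 'j \<Rightarrow> bool" where
  "reachable_in 0 v \<longleftrightarrow> v = Inr root"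
| "reachable_in (Suc n) v \<longleftrightarrow> (\<exists>w. reachable_in n w \<and> badj E w v)"

lemma reachable_in_walk_nth:
  assumes "is_walk E vs" "hd vs = Inr root" "k < length vs"
  shows "reachable_in k (vs ! k)"
  using assms(3)
proof (induction k)
  case 0
  then show ?case using assms(2) by (cases vs) auto
next
  case (Suc k)
  then have "badj E (vs ! k) (vs ! Suc k)" using assms(1) unfolding is_walk_def by auto
  then show ?case using Suc by auto
qed

lemma reachable_in_exists: "\<exists>n. reachable_in n v"
proof -
  obtain vs where vs: "vs \<noteq> []" "hd vs = Inr root" "last vs = v" "is_walk E vs"
    using tree unfolding bip_tree_def bconnected_def by blast
  have "reachable_in (length vs - 1) (vs ! (length vs - 1))"
    using vs by (intro reachable_in_walk_nth) auto
  then show ?thesis using vs by (metis last_conv_nth)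
qed

lemma reachable_in_parity:
  "reachable_in n v \<Longrightarrow> (case v of Inl i \<Rightarrow> odd n | Inr j \<Rightarrow> even n)"
proof (induction n arbitrary: v)
  case (Suc n)
  then obtain w where "reachable_in n w" "badj E w v" by auto
  then show ?case using Suc.IH[of w] by (elim badj_cases) auto
qed auto

definition depth :: "'i + 'j \<Rightarrow> nat" where
  "depth v = (LEAST n. reachable_in n v)"

lemma reachable_in_depth: "reachable_in (depth v) v"
  unfolding depth_def using reachable_in_exists by (metis LeastI_ex)

lemma depth_le: "reachable_in n v \<Longrightarrow> depth v \<le> n"
  unfolding depth_def by (rule Least_le)

lemma depth_root [simp]: "depth (Inr root) = 0"
  using depth_le[of 0 "Inr root"] by simp

lemma depth_eq_0_iff: "depth v = 0 \<longleftrightarrow> v = Inr root"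
  using reachable_in_depth[of v] by (metis depth_root reachable_in.simps(1))

lemma depth_Inl_pos: "0 < depth (Inl i)"
  using depth_eq_0_iff[of "Inl i"] by simp

lemma depth_adj_le: "badj E w v \<Longrightarrow> depth v \<le> depth w + 1"
  using depth_le[of "Suc (depth w)" v] reachable_in_depth[of w] by auto

lemma depth_adj: "badj E w v \<Longrightarrow> depth v = depth w + 1 \<or> depth w = depth v + 1"
proof -
  assume adj: "badj E w v"
  have "depth v \<le> depth w + 1" "depth w \<le> depth v + 1"
    using depth_adj_le adj badj_sym by metis+
  moreover have "odd (depth v + depth w)"
    using adj reachable_in_parity[OF reachable_in_depth, of v] reachable_in_parity[OF reachable_in_depth, of w]
    by (elim badj_cases) auto
  then have "depth v \<noteq> depth w" by auto
  ultimately show ?thesis by linarith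
qed

definition parent :: "'i + 'j \<Rightarrow> 'i + 'j" where
  "parent v = (SOME w. badj E w v \<and> depth w + 1 = depth v)"

lemma parent_exists: "v \<noteq> Inr root \<Longrightarrow> \<exists>w. badj E w v \<and> depth w + 1 = depth v"
proof -
  assume "v \<noteq> Inr root"
  then obtain n where n: "depth v = Suc n" using depth_eq_0_iff by (cases "depth v") auto
  then obtain w where w: "reachable_in n w" "badj E w v" using reachable_in_depth[of v] by auto
  moreover have "depth w + 1 = depth v" using depth_le[OF w(1)] depth_adj_le[OF w(2)] n by simp
  ultimately show ?thesis by blast
qed

lemma
  assumes "v \<noteq> Inr root"
  shows parent_adj: "badj E (parent v) v" and depth_parent: "depth (parent v) + 1 = depth v"
  using someI_ex[OF parent_exists[OF assms]] unfolding parent_def by simp_all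

lemma depth_ancestor: "k \<le> depth v \<Longrightarrow> depth ((parent ^^ k) v) = depth v - k"
proof (induction k)
  case (Suc k)
  then have IH: "depth ((parent ^^ k) v) = depth v - k" by simp
  with Suc.prems have "(parent ^^ k) v \<noteq> Inr root" using depth_eq_0_iff by fastforce
  then have "depth ((parent ^^ Suc k) v) + 1 = depth ((parent ^^ k) v)"
    using depth_parent by simp
  then show ?case using IH Suc.prems by linarith
qed simp

lemma ancestor_ne_root: "k < depth v \<Longrightarrow> (parent ^^ k) v \<noteq> Inr root"
  using depth_ancestor[of k v] depth_eq_0_iff by fastforce

lemma ancestors_walk:
  assumes "n \<le> depth v"
  shows "successively (badj E) (map (\<lambda>k. (parent ^^ k) v) [0..<Suc n])"
  unfolding successively_conv_nth
proof (intro allI impI)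
  fix k assume "Suc k < length (map (\<lambda>k. (parent ^^ k) v) [0..<Suc n])"
  then have k: "k < n" by simp
  then have "(parent ^^ k) v \<noteq> Inr root"
    using ancestor_ne_root assms by simp
  then have "badj E ((parent ^^ k) v) (parent ((parent ^^ k) v))"
    by (subst badj_sym) (rule parent_adj)
  moreover have "map (\<lambda>k. (parent ^^ k) v) [0..<Suc n] ! k = (parent ^^ k) v"
    "map (\<lambda>k. (parent ^^ k) v) [0..<Suc n] ! Suc k = parent ((parent ^^ k) v)"
    using k by (simp_all only: nth_map_upt) simp_all
  ultimately show "badj E (map (\<lambda>k. (parent ^^ k) v) [0..<Suc n] ! k)
      (map (\<lambda>k. (parent ^^ k) v) [0..<Suc n] ! Suc k)"
    by simp
qed

lemma ancestors_meet:
  assumes "depth w = depth w'" and "w \<noteq> w'"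
  obtains K where "0 < K" and "K \<le> depth w" and "(parent ^^ K) w = (parent ^^ K) w'"
    and "\<And>k. k < K \<Longrightarrow> (parent ^^ k) w \<noteq> (parent ^^ k) w'"
proof -
  define K where "K = (LEAST k. (parent ^^ k) w = (parent ^^ k) w')"
  have "(parent ^^ depth w) w = (parent ^^ depth w) w'"
    using depth_ancestor[of "depth w" w] depth_ancestor[of "depth w" w'] assms(1) depth_eq_0_iff by simp
  then have meet: "(parent ^^ K) w = (parent ^^ K) w'" and "K \<le> depth w"
    unfolding K_def by (auto intro: LeastI Least_le)
  moreover have "k < K \<Longrightarrow> (parent ^^ k) w \<noteq> (parent ^^ k) w'" for k
    unfolding K_def by (rule not_less_Least)
  moreover have "K \<noteq> 0"
  proof
    assume "K = 0"
    with meet assms(2) show False by simp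
  qed
  ultimately show ?thesis using that by blast
qed

lemma ancestors_cycle_walk:
  assumes adj: "badj E w v" "badj E w' v" and K: "0 < K" "K \<le> depth w" "K \<le> depth w'"
    and meet: "(parent ^^ K) w = (parent ^^ K) w'"
  shows "successively (badj E)
    (v # map (\<lambda>k. (parent ^^ k) w) [0..<Suc K] @ rev (map (\<lambda>k. (parent ^^ k) w') [0..<K]))"
    (is "successively _ (v # ?as @ rev ?bs)")
proof -
  have walk_as: "successively (badj E) ?as" using ancestors_walk K by simp
  have "successively (badj E) (?bs @ [(parent ^^ K) w'])" using ancestors_walk[OF K(3)] by simp
  then have walk_bs: "successively (badj E) ?bs"
    and "badj E ((parent ^^ (K - 1)) w') ((parent ^^ K) w')"
    using K(1) by (auto simp: successively_append_iff last_map)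
  moreover have "last ?as = (parent ^^ K) w" "hd (rev ?bs) = (parent ^^ (K - 1)) w'"
    using K(1) by (simp_all add: hd_rev last_map)
  ultimately have "badj E (last ?as) (hd (rev ?bs))" using meet badj_sym by metis
  moreover have "hd ?as = w" by (simp add: upt_conv_Cons del: upt_Suc)
  then have "badj E v (hd ?as)" using adj(1) badj_sym by metis
  moreover have "successively (\<lambda>x y. badj E y x) ?bs"
    by (rule successively_mono[OF walk_bs]) (metis badj_sym)
  then have "successively (badj E) (rev ?bs)" by simp
  moreover have "?bs \<noteq> []" using K(1) by simp
  ultimately show ?thesis using walk_as by (simp add: successively_Cons successively_append_iff)
qed

text \<open>Two different parents of v would yield two ancestor chains which, closed up at their
  first common vertex and through v, form a cycle.\<close>
lemma parent_unique:
  assumes adj: "badj E w v" and depth_w: "depth w + 1 = depth v"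
  shows "w = parent v"
proof (rule ccontr)
  assume ne: "w \<noteq> parent v"
  have "v \<noteq> Inr root" using depth_w by auto
  then have adj': "badj E (parent v) v" and depth_w': "depth (parent v) = depth w"
    using parent_adj depth_parent[of v] depth_w by auto
  obtain K where K: "0 < K" "K \<le> depth w" and meet: "(parent ^^ K) w = (parent ^^ K) (parent v)"
    and before_meet: "\<And>k. k < K \<Longrightarrow> (parent ^^ k) w \<noteq> (parent ^^ k) (parent v)"
    using ancestors_meet[OF depth_w'[symmetric] ne] by blast
  define as where "as = map (\<lambda>k. (parent ^^ k) w) [0..<Suc K]"
  define bs where "bs = map (\<lambda>k. (parent ^^ k) (parent v)) [0..<K]"
  define cyc where "cyc = v # as @ rev bs"
  have "successively (badj E) cyc"
    unfolding cyc_def as_def bs_def using ancestors_cycle_walk[OF adj adj' K] K(2) depth_w' meet by simp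
  moreover have "distinct cyc"
  proof -
    have depth_as: "depth ((parent ^^ k) w) = depth w - k" if "k \<le> K" for k
      using depth_ancestor K(2) that by simp
    have depth_bs: "depth ((parent ^^ k) (parent v)) = depth w - k" if "k \<le> K" for k
      using depth_ancestor[of k "parent v"] depth_w' K(2) that by simp
    have "distinct as" "distinct bs"
      using depth_as depth_bs K(2) unfolding as_def bs_def
      by (auto simp: distinct_map inj_on_def simp del: upt_Suc dest!: arg_cong[of _ _ depth])
    moreover have "set as \<inter> set bs = {}"
    proof -
      have "(parent ^^ m) w \<noteq> (parent ^^ m') (parent v)" if "m \<le> K" "m' < K" for m m'
      proof
        assume eq: "(parent ^^ m) w = (parent ^^ m') (parent v)"
        then have "m = m'" using depth_as[of m] depth_bs[of m'] that K(2) by simp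
        then show False using eq before_meet that by simp
      qed
      then show ?thesis unfolding as_def bs_def by (auto simp del: upt_Suc simp: less_Suc_eq_le)
    qed
    moreover have "depth u < depth v" if "u \<in> set as \<union> set bs" for u
      using that depth_as depth_bs depth_w unfolding as_def bs_def
      by (auto simp del: upt_Suc simp: less_Suc_eq_le)
    then have "v \<notin> set as" "v \<notin> set bs" by auto
    ultimately show ?thesis unfolding cyc_def by simp
  qed
  moreover have "last cyc = parent v"
    using K(1) unfolding cyc_def as_def bs_def by (simp add: last_rev hd_map)
  then have "badj E (last cyc) (hd cyc)" using adj' unfolding cyc_def by simp
  moreover have "3 \<le> length cyc" using K(1) unfolding cyc_def as_def bs_def by simp
  ultimately have "has_cycle E" unfolding has_cycle_def is_walk_iff_successively by blast
  then show False using tree unfolding bip_tree_def by simp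
qed

lemma edge_parent_cases:
  assumes "E i j"
  shows "parent (Inl i) = Inr j \<or> (j \<noteq> root \<and> parent (Inr j) = Inl i)"
proof -
  have adj: "badj E (Inr j) (Inl i)" "badj E (Inl i) (Inr j)" using assms by auto
  from depth_adj[OF adj(1)] show ?thesis
  proof
    assume "depth (Inl i) = depth (Inr j) + 1"
    then show ?thesis using parent_unique[OF adj(1)] by simp
  next
    assume d: "depth (Inr j) = depth (Inl i) + 1"
    then have "j \<noteq> root" by auto
    then show ?thesis using parent_unique[OF adj(2)] d by simp
  qed
qed

definition parent_pool :: "'i \<Rightarrow> 'j" where
  "parent_pool i = projr (parent (Inl i))"

lemma parent_Inl: "parent (Inl i) = Inr (parent_pool i)" and edge_parent_pool: "E i (parent_pool i)"
  using parent_adj[of "Inl i"] unfolding parent_pool_def by (auto elim: badj_cases)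

definition child_pools :: "'i \<Rightarrow> 'j set" where
  "child_pools i = {j. j \<noteq> root \<and> parent (Inr j) = Inl i}"

lemma edge_child_pool: "j \<in> child_pools i \<Longrightarrow> E i j"
  using parent_adj[of "Inr j"] unfolding child_pools_def by auto

lemma parent_pool_not_child: "parent_pool i \<notin> child_pools i"
  using depth_parent[of "Inl i"] depth_parent[of "Inr (parent_pool i)"]
  unfolding child_pools_def parent_Inl by auto

lemma depth_child_pool: "j \<in> child_pools i \<Longrightarrow> depth (Inr j) = depth (Inl i) + 1"
  using depth_parent[of "Inr j"] unfolding child_pools_def by auto

definition subtree :: "'i + 'j \<Rightarrow> ('i + 'j) set" where
  "subtree v = {u. depth v \<le> depth u \<and> (parent ^^ (depth u - depth v)) u = v}"

definition children :: "'i + 'j \<Rightarrow> ('i + 'j) set" where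
  "children v = {c. c \<noteq> Inr root \<and> parent c = v}"

lemma depth_subtree: "u \<in> subtree v \<Longrightarrow> depth v \<le> depth u"
  unfolding subtree_def by simp

lemma subtree_root: "subtree (Inr root) = UNIV"
  using depth_ancestor[of "depth u" u for u] depth_eq_0_iff unfolding subtree_def by auto

lemma depth_child: "c \<in> children v \<Longrightarrow> depth c = depth v + 1"
  unfolding children_def using depth_parent by auto

lemma subtree_eq_insert_children: "subtree v = insert v (\<Union>c\<in>children v. subtree c)"
proof (intro equalityI subsetI)
  fix u assume u: "u \<in> subtree v"
  show "u \<in> insert v (\<Union>c\<in>children v. subtree c)"
  proof (cases "depth u = depth v")
    case True
    then show ?thesis using u unfolding subtree_def by simp
  next
    case False
    define n where "n = depth u - depth v"
    have "n \<noteq> 0" using u False unfolding subtree_def n_def by simp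
    define c where "c = (parent ^^ (n - 1)) u"
    have depth_c: "depth c = depth v + 1"
      using depth_ancestor[of "n - 1" u] \<open>n \<noteq> 0\<close> u unfolding c_def n_def subtree_def by simp
    have "parent c = (parent ^^ n) u"
      using \<open>n \<noteq> 0\<close> unfolding c_def by (metis Suc_pred' bot_nat_0.not_eq_extremum comp_apply funpow.simps(2))
    then have "c \<in> children v" using u depth_c unfolding children_def subtree_def n_def by auto
    moreover have "u \<in> subtree c"
      using u depth_c \<open>n \<noteq> 0\<close> unfolding subtree_def c_def n_def by (simp add: Suc_diff_Suc)
    ultimately show ?thesis by blast
  qed
next
  fix u assume "u \<in> insert v (\<Union>c\<in>children v. subtree c)"
  then consider "u = v" | c where "c \<in> children v" "u \<in> subtree c" by blast
  then show "u \<in> subtree v"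
  proof cases
    case 2
    have depth_c: "depth c = depth v + 1" using depth_child[OF 2(1)] .
    moreover have "depth c \<le> depth u" using depth_subtree[OF 2(2)] .
    ultimately have "depth u - depth v = Suc (depth u - depth c)" by simp
    then have "(parent ^^ (depth u - depth v)) u = parent c"
      using 2(2) unfolding subtree_def by simp
    then show ?thesis using 2(1) depth_c \<open>depth c \<le> depth u\<close> unfolding children_def subtree_def by simp
  qed (simp add: subtree_def)
qed

lemma subtree_children_disjoint:
  "c \<in> children v \<Longrightarrow> c' \<in> children v \<Longrightarrow> c \<noteq> c' \<Longrightarrow> subtree c \<inter> subtree c' = {}"
  using depth_child[of c v] depth_child[of c' v] unfolding subtree_def by auto

definition subtree_sum :: "('i + 'j \<Rightarrow> real) \<Rightarrow> 'i + 'j \<Rightarrow> real" where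
  "subtree_sum w v = (\<Sum>u\<in>subtree v. w u)"

lemma subtree_sum_rec: "subtree_sum w v = w v + (\<Sum>c\<in>children v. subtree_sum w c)"
proof -
  have "v \<notin> (\<Union>c\<in>children v. subtree c)" using depth_child depth_subtree by fastforce
  then have "subtree_sum w v = w v + (\<Sum>u\<in>(\<Union>c\<in>children v. subtree c). w u)"
    unfolding subtree_sum_def by (subst subtree_eq_insert_children) simp
  also have "(\<Sum>u\<in>(\<Union>c\<in>children v. subtree c). w u) = (\<Sum>c\<in>children v. subtree_sum w c)"
    unfolding subtree_sum_def using subtree_children_disjoint by (subst sum.UNION_disjoint) auto
  finally show ?thesis .
qed

lemma children_Inl: "children (Inl i) = Inr ` child_pools i"
  using parent_adj unfolding children_def child_pools_def by (force elim: badj_cases)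

lemma children_Inr: "children (Inr j) = Inl ` {i. parent_pool i = j}"
  using parent_adj unfolding children_def by (force elim: badj_cases simp: parent_Inl)

definition flow_weight :: "('i \<Rightarrow> real) \<Rightarrow> ('j \<Rightarrow> real) \<Rightarrow> 'i + 'j \<Rightarrow> real" where
  "flow_weight \<alpha> \<beta> = case_sum \<alpha> (\<lambda>j. - \<beta> j)"

definition tree_flow :: "('i \<Rightarrow> real) \<Rightarrow> ('j \<Rightarrow> real) \<Rightarrow> 'i \<Rightarrow> 'j \<Rightarrow> real" where
  "tree_flow \<alpha> \<beta> i j =
     (if j = parent_pool i then subtree_sum (flow_weight \<alpha> \<beta>) (Inl i)
      else if j \<in> child_pools i then - subtree_sum (flow_weight \<alpha> \<beta>) (Inr j) else 0)"

lemma subtree_sum_Inl: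
  "subtree_sum w (Inl i) = w (Inl i) + (\<Sum>j\<in>child_pools i. subtree_sum w (Inr j))"
  using subtree_sum_rec[of w "Inl i"] by (simp add: children_Inl sum.reindex)

lemma subtree_sum_Inr:
  "subtree_sum w (Inr j) = w (Inr j) + (\<Sum>i | parent_pool i = j. subtree_sum w (Inl i))"
  using subtree_sum_rec[of w "Inr j"] by (simp add: children_Inr sum.reindex)

lemma tree_flow_support: "\<not> E i j \<Longrightarrow> tree_flow \<alpha> \<beta> i j = 0"
  using edge_parent_pool edge_child_pool unfolding tree_flow_def by auto

lemma tree_flow_weighted_row_sum:
  "(\<Sum>j\<in>UNIV. c j * tree_flow \<alpha> \<beta> i j) = c (parent_pool i) * subtree_sum (flow_weight \<alpha> \<beta>) (Inl i)
     - (\<Sum>j\<in>child_pools i. c j * subtree_sum (flow_weight \<alpha> \<beta>) (Inr j))"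
proof -
  have "c j * tree_flow \<alpha> \<beta> i j =
      (if j = parent_pool i then c j * subtree_sum (flow_weight \<alpha> \<beta>) (Inl i) else 0)
      - (if j \<in> child_pools i then c j * subtree_sum (flow_weight \<alpha> \<beta>) (Inr j) else 0)" for j
    using parent_pool_not_child[of i] unfolding tree_flow_def by auto
  then show ?thesis by (simp add: sum_subtractf sum.If_cases)
qed

lemma tree_flow_row_sum: "(\<Sum>j\<in>UNIV. tree_flow \<alpha> \<beta> i j) = \<alpha> i"
  using tree_flow_weighted_row_sum[of "\<lambda>_. 1"] subtree_sum_Inl[of _ i]
  by (simp add: flow_weight_def)

lemma tree_flow_col_sum:
  assumes balance: "sum \<alpha> UNIV = sum \<beta> UNIV"
  shows "(\<Sum>i\<in>UNIV. tree_flow \<alpha> \<beta> i j) = \<beta> j"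
proof -
  let ?S = "subtree_sum (flow_weight \<alpha> \<beta>)"
  have "tree_flow \<alpha> \<beta> i j = (if parent_pool i = j then ?S (Inl i) else 0)
      - (if j \<noteq> root \<and> parent (Inr j) = Inl i then ?S (Inr j) else 0)" for i
    using parent_pool_not_child[of i] unfolding tree_flow_def child_pools_def by auto
  then have "(\<Sum>i\<in>UNIV. tree_flow \<alpha> \<beta> i j) = ?S (Inr j) + \<beta> j
      - (\<Sum>i\<in>UNIV. if j \<noteq> root \<and> parent (Inr j) = Inl i then ?S (Inr j) else 0)"
    using subtree_sum_Inr[of _ j] by (simp add: sum_subtractf sum.If_cases flow_weight_def)
  also have "(\<Sum>i\<in>UNIV. if j \<noteq> root \<and> parent (Inr j) = Inl i then ?S (Inr j) else 0) = ?S (Inr j)"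
  proof (cases "j = root")
    case True
    have "?S (Inr root) = (\<Sum>i\<in>UNIV. \<alpha> i) - (\<Sum>j\<in>UNIV. \<beta> j)"
      unfolding subtree_sum_def subtree_root sum_UNIV_sum_type by (simp add: flow_weight_def sum_negf)
    then show ?thesis using True balance by simp
  next
    case False
    then obtain i where "parent (Inr j) = Inl i"
      using parent_adj[of "Inr j"] by (auto elim: badj_cases)
    then show ?thesis using False by simp
  qed
  finally show ?thesis by simp
qed

lemma zero_margins_edge_function_eq_0:
  assumes rows: "\<forall>i. (\<Sum>j\<in>UNIV. \<phi> i j) = (0::real)"
    and cols: "\<forall>j. (\<Sum>i\<in>UNIV. \<phi> i j) = 0"
    and support: "\<forall>i j. \<not> E i j \<longrightarrow> \<phi> i j = 0"
  shows "\<phi> i j = 0"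
proof -
  define D where "D = Max (range depth)"
  have "depth v \<le> D" for v unfolding D_def by simp
  \<comment> \<open>Upwards from the leaves: at the lower endpoint of an edge every other edge leads further
    down, where \<phi> already vanishes, so the zero margin at that endpoint kills the edge.\<close>
  define h where "h i j = D - max (depth (Inl i)) (depth (Inr j))" for i j
  show ?thesis
  proof (induction "h i j" arbitrary: i j rule: less_induct)
    case less
    show ?case
    proof (cases "E i j")
      case edge: True
      from edge_parent_cases[OF edge] show ?thesis
      proof
        assume up: "parent (Inl i) = Inr j"
        have "\<phi> i j' = 0" if "j' \<noteq> j" for j'
        proof (cases "E i j'")
          case True
          then have "parent (Inr j') = Inl i" "j' \<noteq> root" using edge_parent_cases[of i j'] up that by auto
          then have "h i j' < h i j"
            using depth_parent[of "Inl i"] depth_parent[of "Inr j'"] \<open>depth (Inr j') \<le> D\<close> up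
            unfolding h_def by auto
          then show ?thesis using less by blast
        qed (use support in blast)
        then have "(\<Sum>j'\<in>UNIV. \<phi> i j') = \<phi> i j" by (subst sum.remove[of _ j]) auto
        then show ?thesis using rows by simp
      next
        assume down: "j \<noteq> root \<and> parent (Inr j) = Inl i"
        have "\<phi> i' j = 0" if "i' \<noteq> i" for i'
        proof (cases "E i' j")
          case True
          then have "parent (Inl i') = Inr j" using edge_parent_cases[of i' j] down that by auto
          then have "h i' j < h i j"
            using depth_parent[of "Inr j"] depth_parent[of "Inl i'"] \<open>depth (Inl i') \<le> D\<close> down
            unfolding h_def by auto
          then show ?thesis using less by blast
        qed (use support in blast)
        then have "(\<Sum>i'\<in>UNIV. \<phi> i' j) = \<phi> i j" by (subst sum.remove[of _ i]) auto
        then show ?thesis using cols by simp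
      qed
    qed (use support in blast)
  qed
qed

lemma Gmat_eq_tree_flow:
  assumes balance: "sum \<alpha> UNIV = sum \<beta> UNIV"
  shows "Gmat E \<alpha> \<beta> = tree_flow \<alpha> \<beta>"
  unfolding Gmat_def
proof (rule the_equality)
  show "(\<forall>i. (\<Sum>j\<in>UNIV. tree_flow \<alpha> \<beta> i j) = \<alpha> i) \<and> (\<forall>j. (\<Sum>i\<in>UNIV. tree_flow \<alpha> \<beta> i j) = \<beta> j)
        \<and> (\<forall>i j. \<not> E i j \<longrightarrow> tree_flow \<alpha> \<beta> i j = 0)"
    using tree_flow_row_sum tree_flow_col_sum[OF balance] tree_flow_support by blast
next
  fix \<psi> assume \<psi>: "(\<forall>i. (\<Sum>j\<in>UNIV. \<psi> i j) = \<alpha> i) \<and> (\<forall>j. (\<Sum>i\<in>UNIV. \<psi> i j) = \<beta> j)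
        \<and> (\<forall>i j. \<not> E i j \<longrightarrow> \<psi> i j = 0)"
  have "\<psi> i j - tree_flow \<alpha> \<beta> i j = 0" for i j
    by (rule zero_margins_edge_function_eq_0[of "\<lambda>i j. \<psi> i j - tree_flow \<alpha> \<beta> i j"])
      (use \<psi> tree_flow_row_sum tree_flow_col_sum[OF balance] tree_flow_support
        in \<open>auto simp: sum_subtractf\<close>)
  then show "\<psi> = tree_flow \<alpha> \<beta>" by (auto simp: fun_eq_iff)
qed

end

section \<open>Geometric weights for triangular couplings\<close>

lemma two_mult_le_weighted_squares:
  fixes a b e :: real
  assumes "0 < e"
  shows "2 * (a * b) \<le> e * a\<^sup>2 + b\<^sup>2 / e"
proof -
  have "0 \<le> (e * a - b)\<^sup>2" by simp
  then have "2 * e * (a * b) \<le> e\<^sup>2 * a\<^sup>2 + b\<^sup>2" by (simp add: power2_eq_square algebra_simps)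
  then show ?thesis using assms by (simp add: field_simps power2_eq_square)
qed

lemma higher_rank_cross_term_le:
  fixes rank :: "'n::finite \<Rightarrow> nat" and y :: "'n \<Rightarrow> real"
  assumes "0 < d"
  shows "K * \<bar>y i\<bar> * (\<Sum>k | rank i < rank k. \<bar>y k\<bar>)
    \<le> d / 2 * (y i)\<^sup>2 + real CARD('n) * K\<^sup>2 / (2 * d) * (\<Sum>k | rank i < rank k. (y k)\<^sup>2)"
proof -
  define N where "N = real CARD('n)"
  have "0 < N" unfolding N_def by simp
  have pair: "K * \<bar>y i\<bar> * \<bar>y k\<bar> \<le> d / (2 * N) * (y i)\<^sup>2 + N * K\<^sup>2 / (2 * d) * (y k)\<^sup>2" for k
    using two_mult_le_weighted_squares[of "d / N" "\<bar>y i\<bar>" "K * \<bar>y k\<bar>"] assms \<open>0 < N\<close>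
    by (simp add: field_simps power2_eq_square)
  have "K * \<bar>y i\<bar> * (\<Sum>k | rank i < rank k. \<bar>y k\<bar>) = (\<Sum>k | rank i < rank k. K * \<bar>y i\<bar> * \<bar>y k\<bar>)"
    by (simp add: sum_distrib_left)
  also have "\<dots> \<le> (\<Sum>k | rank i < rank k. d / (2 * N) * (y i)\<^sup>2 + N * K\<^sup>2 / (2 * d) * (y k)\<^sup>2)"
    by (rule sum_mono) (rule pair)
  also have "\<dots> = real (card {k. rank i < rank k}) * (d / (2 * N) * (y i)\<^sup>2)
      + N * K\<^sup>2 / (2 * d) * (\<Sum>k | rank i < rank k. (y k)\<^sup>2)"
    by (simp add: sum.distrib sum_distrib_left)
  also have "\<dots> \<le> N * (d / (2 * N) * (y i)\<^sup>2) + N * K\<^sup>2 / (2 * d) * (\<Sum>k | rank i < rank k. (y k)\<^sup>2)"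
    using assms unfolding N_def by (intro add_right_mono mult_right_mono) (simp_all add: card_mono)
  finally show ?thesis using \<open>0 < N\<close> unfolding N_def by simp
qed

lemma geometric_rank_weights_absorb:
  fixes rank :: "'n::finite \<Rightarrow> nat" and f :: "'n \<Rightarrow> real"
  assumes "1 \<le> \<rho>" and "\<forall>k. 0 \<le> f k"
  shows "(\<Sum>i\<in>UNIV. \<rho> ^ rank i * (\<Sum>k | rank i < rank k. f k))
    \<le> real CARD('n) / \<rho> * (\<Sum>k\<in>UNIV. \<rho> ^ rank k * f k)"
proof -
  have "(\<Sum>i\<in>UNIV. \<rho> ^ rank i * (\<Sum>k | rank i < rank k. f k))
      = (\<Sum>k\<in>UNIV. \<Sum>i | rank i < rank k. \<rho> ^ rank i * f k)"
    using sum.swap_restrict[of "UNIV :: 'n set" UNIV "\<lambda>i k. \<rho> ^ rank i * f k" "\<lambda>i k. rank i < rank k"]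
    by (simp add: sum_distrib_left)
  also have "\<dots> \<le> (\<Sum>k\<in>UNIV. real CARD('n) * (\<rho> ^ rank k / \<rho> * f k))"
  proof (rule sum_mono)
    fix k
    have "\<rho> ^ rank i \<le> \<rho> ^ rank k / \<rho>" if "rank i < rank k" for i
      using power_increasing[of "Suc (rank i)" "rank k" \<rho>] that assms(1) by (simp add: field_simps)
    then have "(\<Sum>i | rank i < rank k. \<rho> ^ rank i * f k) \<le> (\<Sum>i | rank i < rank k. \<rho> ^ rank k / \<rho> * f k)"
      using assms(2) by (intro sum_mono mult_right_mono) auto
    also have "\<dots> = real (card {i. rank i < rank k}) * (\<rho> ^ rank k / \<rho> * f k)" by simp
    also have "\<dots> \<le> real CARD('n) * (\<rho> ^ rank k / \<rho> * f k)"
      using assms by (intro mult_right_mono) (simp_all add: card_mono)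
    finally show "(\<Sum>i | rank i < rank k. \<rho> ^ rank i * f k) \<le> real CARD('n) * (\<rho> ^ rank k / \<rho> * f k)" .
  qed
  finally show ?thesis by (simp add: sum_distrib_left mult_ac)
qed

text \<open>Coordinates are weighted geometrically by rank, so that the coupling of each coordinate
  to those of higher rank is absorbed by the diagonal terms of the latter.\<close>
lemma triangular_coercive_weights:
  fixes rank :: "'n::finite \<Rightarrow> nat" and d K :: real
  assumes "0 < d"
  obtains q :: "'n \<Rightarrow> real" where "\<forall>i. 1 \<le> q i"
    and "\<And>y m. (\<And>i. d * (y i)\<^sup>2 - K * \<bar>y i\<bar> * (\<Sum>i' | rank i < rank i'. \<bar>y i'\<bar>) \<le> y i * m i)
           \<Longrightarrow> d / 4 * (\<Sum>i\<in>UNIV. (y i)\<^sup>2) \<le> (\<Sum>i\<in>UNIV. q i * (y i * m i))"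
proof
  define C where "C = real CARD('n) * K\<^sup>2 / (2 * d)"
  define \<rho> where "\<rho> = 1 + 4 * C * real CARD('n) / d"
  have "0 \<le> C" unfolding C_def using assms by simp
  then have "1 \<le> \<rho>" unfolding \<rho>_def using assms by simp
  then show "\<forall>i. 1 \<le> \<rho> ^ rank i" by simp
  fix y m :: "'n \<Rightarrow> real"
  assume hyp: "\<And>i. d * (y i)\<^sup>2 - K * \<bar>y i\<bar> * (\<Sum>i' | rank i < rank i'. \<bar>y i'\<bar>) \<le> y i * m i"
  define T where "T i = (\<Sum>k | rank i < rank k. (y k)\<^sup>2)" for i
  have "d / 2 * (y i)\<^sup>2 - C * T i \<le> y i * m i" for i
    using hyp[of i] higher_rank_cross_term_le[OF assms, where rank = rank and K = K and y = y and i = i]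
    unfolding C_def T_def by linarith
  then have "(\<Sum>i\<in>UNIV. \<rho> ^ rank i * (d / 2 * (y i)\<^sup>2 - C * T i)) \<le> (\<Sum>i\<in>UNIV. \<rho> ^ rank i * (y i * m i))"
    using \<open>1 \<le> \<rho>\<close> by (intro sum_mono mult_left_mono) auto
  then have "d / 2 * (\<Sum>i\<in>UNIV. \<rho> ^ rank i * (y i)\<^sup>2) - C * (\<Sum>i\<in>UNIV. \<rho> ^ rank i * T i)
      \<le> (\<Sum>i\<in>UNIV. \<rho> ^ rank i * (y i * m i))"
    by (simp add: right_diff_distrib sum_subtractf sum_distrib_left mult_ac)
  moreover have "C * (\<Sum>i\<in>UNIV. \<rho> ^ rank i * T i) \<le> d / 4 * (\<Sum>i\<in>UNIV. \<rho> ^ rank i * (y i)\<^sup>2)"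
  proof -
    have "C * (\<Sum>i\<in>UNIV. \<rho> ^ rank i * T i) \<le> C * (real CARD('n) / \<rho> * (\<Sum>k\<in>UNIV. \<rho> ^ rank k * (y k)\<^sup>2))"
      using geometric_rank_weights_absorb[OF \<open>1 \<le> \<rho>\<close>, of "\<lambda>k. (y k)\<^sup>2" rank] \<open>0 \<le> C\<close>
      unfolding T_def by (intro mult_left_mono) auto
    also have "\<dots> = C * real CARD('n) / \<rho> * (\<Sum>k\<in>UNIV. \<rho> ^ rank k * (y k)\<^sup>2)" by simp
    also have "\<dots> \<le> d / 4 * (\<Sum>i\<in>UNIV. \<rho> ^ rank i * (y i)\<^sup>2)"
    proof (rule mult_right_mono)
      have "0 \<le> 4 * C * real CARD('n)" using \<open>0 \<le> C\<close> by simp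
      then have le_1: "4 * C * real CARD('n) / (d + 4 * C * real CARD('n)) \<le> 1"
        using assms by (simp add: divide_le_eq)
      have "C * real CARD('n) / \<rho> = d / 4 * (4 * C * real CARD('n) / (d + 4 * C * real CARD('n)))"
        unfolding \<rho>_def using assms by (simp add: field_simps)
      also have "\<dots> \<le> d / 4 * 1" by (rule mult_left_mono[OF le_1]) (use assms in simp)
      finally show "C * real CARD('n) / \<rho> \<le> d / 4" by simp
    qed (use \<open>1 \<le> \<rho>\<close> in \<open>simp add: sum_nonneg\<close>)
    finally show ?thesis .
  qed
  moreover have "(\<Sum>i\<in>UNIV. (y i)\<^sup>2) \<le> (\<Sum>i\<in>UNIV. \<rho> ^ rank i * (y i)\<^sup>2)"
    using mult_right_mono[OF one_le_power[OF \<open>1 \<le> \<rho>\<close>], of "(y i)\<^sup>2" "rank i" for i]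
    by (intro sum_mono) simp
  then have "d / 4 * (\<Sum>i\<in>UNIV. (y i)\<^sup>2) \<le> d / 4 * (\<Sum>i\<in>UNIV. \<rho> ^ rank i * (y i)\<^sup>2)"
    using assms by (intro mult_left_mono) auto
  ultimately show "d / 4 * (\<Sum>i\<in>UNIV. (y i)\<^sup>2) \<le> (\<Sum>i\<in>UNIV. \<rho> ^ rank i * (y i * m i))"
    by linarith
qed

section \<open>A smoothed power of a diagonal quadratic form\<close>

lemma partial_eq_of_has_derivative:
  fixes f :: "real^'n::finite \<Rightarrow> real"
  assumes "(f has_derivative (\<lambda>v. \<Sum>k\<in>UNIV. g k * v $ k)) (at x)"
  shows "partial i f x = g i"
proof -
  have line: "((\<lambda>t. x + t *\<^sub>R axis i 1) has_derivative (\<lambda>t. t *\<^sub>R axis i 1)) (at 0)"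
    by (auto intro!: derivative_eq_intros)
  have "(f has_derivative (\<lambda>v. \<Sum>k\<in>UNIV. g k * v $ k)) (at (x + (0::real) *\<^sub>R axis i 1))"
    using assms by simp
  from has_derivative_compose[OF line this]
  have "((\<lambda>t. f (x + t *\<^sub>R axis i 1)) has_derivative (\<lambda>t. \<Sum>k\<in>UNIV. g k * (t *\<^sub>R axis i 1) $ k)) (at 0)"
    .
  moreover have "(\<lambda>t. \<Sum>k\<in>UNIV. g k * (t *\<^sub>R axis i (1::real)) $ k) = (*) (g i)"
    by (simp add: axis_def if_distrib fun_eq_iff mult.commute cong: if_cong)
  ultimately have "((\<lambda>t. f (x + t *\<^sub>R axis i 1)) has_field_derivative g i) (at 0)"
    unfolding has_field_derivative_def by simp
  then show ?thesis unfolding partial_def by (rule DERIV_imp_deriv)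
qed

lemma C2_of_coordinate_derivatives:
  fixes f :: "real^'n::finite \<Rightarrow> real"
  assumes f: "\<And>x. (f has_derivative (\<lambda>v. \<Sum>k\<in>UNIV. g k x * v $ k)) (at x)"
    and g: "\<And>k x. (g k has_derivative (\<lambda>v. \<Sum>l\<in>UNIV. h k l x * v $ l)) (at x)"
    and h: "\<And>k l. continuous_on UNIV (h k l)"
  shows "C2 f"
proof -
  define P :: "'n \<Rightarrow> (real^'n) \<Rightarrow>\<^sub>L real" where "P k = Blinfun (\<lambda>v. v $ k)" for k
  have P: "blinfun_apply (P k) v = v $ k" for k v
    unfolding P_def by (simp add: bounded_linear_Blinfun_apply bounded_linear_vec_nth)
  define T :: "'n \<Rightarrow> 'n \<Rightarrow> (real^'n) \<Rightarrow>\<^sub>L ((real^'n) \<Rightarrow>\<^sub>L real)" where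
    "T k l = Blinfun (\<lambda>v. (v $ l) *\<^sub>R P k)" for k l
  have T: "blinfun_apply (T k l) v = (v $ l) *\<^sub>R P k" for k l v
    unfolding T_def
    by (rule bounded_linear_Blinfun_apply[THEN fun_cong])
       (intro bounded_linear_scaleR_const bounded_linear_vec_nth)
  define f' where "f' x = (\<Sum>k\<in>UNIV. g k x *\<^sub>R P k)" for x
  define f'' where "f'' x = (\<Sum>k\<in>UNIV. \<Sum>l\<in>UNIV. h k l x *\<^sub>R T k l)" for x
  have "blinfun_apply (f' x) = (\<lambda>v. \<Sum>k\<in>UNIV. g k x * v $ k)" for x
    unfolding f'_def by (auto simp: blinfun.sum_left blinfun.scaleR_left P)
  then have "(f has_derivative blinfun_apply (f' x)) (at x)" for x using f by simp
  moreover have "blinfun_apply (f'' x) = (\<lambda>v. \<Sum>k\<in>UNIV. (\<Sum>l\<in>UNIV. h k l x * v $ l) *\<^sub>R P k)" for x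
    unfolding f''_def by (auto simp: blinfun.sum_left blinfun.scaleR_left T scaleR_sum_left)
  then have "(f' has_derivative blinfun_apply (f'' x)) (at x)" for x
    unfolding f'_def[abs_def] by (simp add: has_derivative_sum has_derivative_scaleR_left g)
  moreover have "continuous_on UNIV f''"
    unfolding f''_def[abs_def] by (intro continuous_on_sum continuous_on_scaleR h continuous_on_const)
  ultimately show ?thesis unfolding C2_def by blast
qed

lemma has_real_derivative_glue_at_1:
  fixes f g f' g' :: "real \<Rightarrow> real"
  assumes f: "\<And>t. (f has_real_derivative f' t) (at t)"
    and g: "\<And>t. 0 < t \<Longrightarrow> (g has_real_derivative g' t) (at t)"
    and "f 1 = g 1" and "f' 1 = g' 1"
  shows "((\<lambda>t. if 1 \<le> t then g t else f t) has_real_derivative (if 1 \<le> t then g' t else f' t)) (at t)"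
proof -
  let ?h = "\<lambda>t. if 1 \<le> t then g t else f t"
  consider "t < 1" | "t > 1" | "t = 1" by linarith
  then show ?thesis
  proof cases
    case 1
    have "(?h has_real_derivative f' t) (at t)"
      by (rule has_field_derivative_transform_within_open[OF f, of "{..<1}"]) (use 1 in auto)
    then show ?thesis using 1 by simp
  next
    case 2
    have "(?h has_real_derivative g' t) (at t)"
      by (rule has_field_derivative_transform_within_open[OF g, of _ "{1<..}"]) (use 2 in auto)
    then show ?thesis using 2 by simp
  next
    case 3
    have "(?h has_real_derivative f' 1) (at 1 within {..1})"
      by (rule has_field_derivative_transform_within[OF has_field_derivative_at_within[OF f[of 1]], of 1])
         (use assms(3) in auto)
    moreover have "(?h has_real_derivative g' 1) (at 1 within {1..})"
      by (rule has_field_derivative_transform_within[OF has_field_derivative_at_within[OF g[of 1]], of 1])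
         auto
    ultimately have "((\<lambda>y. (?h y - ?h 1) / (y - 1)) \<longlongrightarrow> g' 1) (at 1 within ({..1} \<union> {1..}))"
      unfolding Lim_within_Un has_field_derivative_iff using assms(4) by simp
    moreover have "{..1} \<union> {1..} = (UNIV :: real set)" by auto
    ultimately show ?thesis using 3 unfolding has_field_derivative_iff by simp
  qed
qed

text \<open>Below 1, t powr p is replaced by its second-order Taylor polynomial at 1, which keeps
  the function twice continuously differentiable on the whole real line.\<close>
definition smooth_powr :: "real \<Rightarrow> real \<Rightarrow> real" where
  "smooth_powr p t = (if 1 \<le> t then t powr p else 1 + p * (t - 1) + p * (p - 1) / 2 * (t - 1)\<^sup>2)"

definition smooth_powr' :: "real \<Rightarrow> real \<Rightarrow> real" where
  "smooth_powr' p t = (if 1 \<le> t then p * t powr (p - 1) else p + p * (p - 1) * (t - 1))"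

definition smooth_powr'' :: "real \<Rightarrow> real \<Rightarrow> real" where
  "smooth_powr'' p t = (if 1 \<le> t then p * (p - 1) * t powr (p - 2) else p * (p - 1))"

lemma has_real_derivative_smooth_powr: "(smooth_powr p has_real_derivative smooth_powr' p t) (at t)"
  unfolding smooth_powr_def[abs_def] smooth_powr'_def
proof (rule has_real_derivative_glue_at_1)
  show "((\<lambda>t. 1 + p * (t - 1) + p * (p - 1) / 2 * (t - 1)\<^sup>2) has_real_derivative p + p * (p - 1) * (t - 1)) (at t)"
    for t by (auto intro!: derivative_eq_intros simp: field_simps power2_eq_square)
qed (simp_all add: has_real_derivative_powr)

lemma has_real_derivative_smooth_powr': "(smooth_powr' p has_real_derivative smooth_powr'' p t) (at t)"
  unfolding smooth_powr'_def[abs_def] smooth_powr''_def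
proof (rule has_real_derivative_glue_at_1)
  show "((\<lambda>t. p * t powr (p - 1)) has_real_derivative p * (p - 1) * t powr (p - 2)) (at t)"
    if "0 < t" for t
    using DERIV_cmult[OF has_real_derivative_powr[OF that, of "p - 1"], of p] by (simp add: mult.assoc)
qed (auto intro!: derivative_eq_intros)

lemma continuous_on_smooth_powr'': "continuous_on UNIV (smooth_powr'' p)"
proof -
  have "continuous_on ({..1} \<union> {1..}) (\<lambda>t. if t \<le> 1 then p * (p - 1) else p * (p - 1) * t powr (p - 2))"
    by (intro continuous_on_cases) (auto intro!: continuous_intros)
  moreover have "(\<lambda>t. if t \<le> 1 then p * (p - 1) else p * (p - 1) * t powr (p - 2)) = smooth_powr'' p"
    unfolding smooth_powr''_def by (auto simp: fun_eq_iff)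
  moreover have "{..1} \<union> {1..} = (UNIV :: real set)" by auto
  ultimately show ?thesis by metis
qed

definition diag_form :: "('n::finite \<Rightarrow> real) \<Rightarrow> real^'n \<Rightarrow> real" where
  "diag_form q x = (\<Sum>i\<in>UNIV. q i * (x $ i)\<^sup>2)"

definition lyapunov_fun :: "('n::finite \<Rightarrow> real) \<Rightarrow> real \<Rightarrow> real^'n \<Rightarrow> real" where
  "lyapunov_fun q p x = smooth_powr p (diag_form q x)"

lemma inner_diag_matrix: "x \<bullet> ((\<chi> i j. if i = j then q i else 0) *v x) = diag_form q x"
proof -
  have "(\<Sum>j\<in>UNIV. (if i = j then q i else 0) * x $ j) = (\<Sum>j\<in>UNIV. if i = j then q i * x $ j else 0)"
    for i by (rule sum.cong) auto
  then have "((\<chi> i j. if i = j then q i else 0) *v x) $ i = q i * x $ i" for i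
    unfolding matrix_vector_mult_def by simp
  then show ?thesis by (simp add: diag_form_def inner_vec_def power2_eq_square mult_ac)
qed

lemma norm_square_le_diag_form:
  assumes "\<forall>i. 1 \<le> q i"
  shows "(norm x)\<^sup>2 \<le> diag_form q x"
  unfolding diag_form_def power2_norm_eq_inner inner_vec_def
proof (intro sum_mono)
  fix i
  show "x $ i \<bullet> x $ i \<le> q i * (x $ i)\<^sup>2"
    using mult_right_mono[of 1 "q i" "(x $ i)\<^sup>2"] assms by (simp add: power2_eq_square)
qed

lemma diag_form_le_norm_square:
  assumes "\<forall>i. 0 \<le> q i"
  shows "diag_form q x \<le> sum q UNIV * (norm x)\<^sup>2"
proof -
  have "(x $ i)\<^sup>2 \<le> (norm x)\<^sup>2" for i
    using power_mono[OF component_le_norm_cart[of x i], of 2] by simp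
  then have "diag_form q x \<le> (\<Sum>i\<in>UNIV. q i * (norm x)\<^sup>2)"
    unfolding diag_form_def using assms by (intro sum_mono mult_left_mono) auto
  then show ?thesis by (simp add: sum_distrib_right)
qed

lemma has_derivative_diag_form:
  "(diag_form q has_derivative (\<lambda>v. \<Sum>k\<in>UNIV. 2 * q k * x $ k * v $ k)) (at x)"
proof -
  have coord: "((\<lambda>x. x $ k) has_derivative (\<lambda>v. v $ k)) (at x)" for k
    by (rule bounded_linear_imp_has_derivative[OF bounded_linear_vec_nth])
  have "(diag_form q has_derivative (\<lambda>v. \<Sum>k\<in>UNIV. q k * (x $ k * v $ k + v $ k * x $ k))) (at x)"
    unfolding diag_form_def[abs_def] power2_eq_square
    by (intro has_derivative_sum has_derivative_mult_right has_derivative_mult coord)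
  then show ?thesis
    by (rule has_derivative_eq_rhs) (auto simp: fun_eq_iff algebra_simps intro!: sum.cong)
qed

lemma has_derivative_lyapunov_fun:
  "(lyapunov_fun q p has_derivative
     (\<lambda>v. \<Sum>k\<in>UNIV. smooth_powr' p (diag_form q x) * (2 * q k * x $ k) * v $ k)) (at x)"
  unfolding lyapunov_fun_def[abs_def]
  using DERIV_compose_FDERIV[OF has_real_derivative_smooth_powr has_derivative_diag_form]
  by (rule has_derivative_eq_rhs) (simp add: fun_eq_iff sum_distrib_left sum_distrib_right mult_ac)

lemma has_derivative_lyapunov_gradient:
  "((\<lambda>x. smooth_powr' p (diag_form q x) * (2 * q k * x $ k)) has_derivative
     (\<lambda>v. \<Sum>l\<in>UNIV. (smooth_powr'' p (diag_form q x) * (2 * q l * x $ l) * (2 * q k * x $ k)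
        + (if k = l then smooth_powr' p (diag_form q x) * (2 * q k) else 0)) * v $ l)) (at x)"
proof -
  let ?s' = "smooth_powr' p (diag_form q x)" and ?s'' = "smooth_powr'' p (diag_form q x)"
  have coord: "((\<lambda>x. 2 * q k * x $ k) has_derivative (\<lambda>v. 2 * q k * v $ k)) (at x)"
    by (intro has_derivative_mult_right bounded_linear_imp_has_derivative[OF bounded_linear_vec_nth])
  have "((\<lambda>x. smooth_powr' p (diag_form q x) * (2 * q k * x $ k)) has_derivative
     (\<lambda>v. ?s' * (2 * q k * v $ k) + (\<Sum>l\<in>UNIV. 2 * q l * x $ l * v $ l) * ?s'' * (2 * q k * x $ k))) (at x)"
    using has_derivative_mult[OF DERIV_compose_FDERIV[OF has_real_derivative_smooth_powr'[of p]
          has_derivative_diag_form[of q]] coord]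
    by (simp add: mult_ac)
  moreover have "(\<Sum>l\<in>UNIV. (?s'' * (2 * q l * x $ l) * (2 * q k * x $ k)
        + (if k = l then ?s' * (2 * q k) else 0)) * v $ l)
      = ?s' * (2 * q k * v $ k) + (\<Sum>l\<in>UNIV. 2 * q l * x $ l * v $ l) * ?s'' * (2 * q k * x $ k)" for v
  proof -
    have "(\<Sum>l\<in>UNIV. (if k = l then ?s' * (2 * q k) else 0) * v $ l) = ?s' * (2 * q k * v $ k)"
      by (subst sum.cong[OF refl, of _ _ "\<lambda>l. if k = l then ?s' * (2 * q k) * v $ l else 0"]) auto
    then show ?thesis
      unfolding distrib_right sum.distrib by (simp add: sum_distrib_left sum_distrib_right mult_ac)
  qed
  ultimately show ?thesis by simp
qed

lemma continuous_on_smooth_powr_diag_form: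
  "continuous_on UNIV (\<lambda>x. smooth_powr p (diag_form q x))"
  "continuous_on UNIV (\<lambda>x. smooth_powr' p (diag_form q x))"
  "continuous_on UNIV (\<lambda>x. smooth_powr'' p (diag_form q x))"
proof -
  have form: "continuous_on UNIV (diag_form q)"
    using has_derivative_diag_form by (meson continuous_at_imp_continuous_on has_derivative_continuous)
  have "continuous_on UNIV (smooth_powr p)" "continuous_on UNIV (smooth_powr' p)"
    using has_real_derivative_smooth_powr has_real_derivative_smooth_powr'
    by (meson DERIV_isCont continuous_at_imp_continuous_on)+
  then show "continuous_on UNIV (\<lambda>x. smooth_powr p (diag_form q x))"
    "continuous_on UNIV (\<lambda>x. smooth_powr' p (diag_form q x))"
    "continuous_on UNIV (\<lambda>x. smooth_powr'' p (diag_form q x))"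
    using continuous_on_smooth_powr'' by (auto intro: continuous_on_compose2[OF _ form])
qed

lemma C2_lyapunov_fun: "C2 (lyapunov_fun q p)"
proof (rule C2_of_coordinate_derivatives[OF has_derivative_lyapunov_fun has_derivative_lyapunov_gradient])
  note s' = continuous_on_smooth_powr_diag_form(2) and s'' = continuous_on_smooth_powr_diag_form(3)
  show "continuous_on UNIV (\<lambda>x. smooth_powr'' p (diag_form q x) * (2 * q l * x $ l) *
      (2 * q k * x $ k) + (if k = l then smooth_powr' p (diag_form q x) * (2 * q k) else 0))" for k l
    by (cases "k = l") (simp_all, (intro continuous_intros s' s'')+)
qed

lemma partial_lyapunov_fun:
  "partial i (lyapunov_fun q p) = (\<lambda>x. smooth_powr' p (diag_form q x) * (2 * q i * x $ i))"
  using partial_eq_of_has_derivative[OF has_derivative_lyapunov_fun] by (rule ext)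

lemma partial2_lyapunov_fun:
  "partial i (partial i (lyapunov_fun q p)) x =
     smooth_powr'' p (diag_form q x) * (2 * q i * x $ i)\<^sup>2 + smooth_powr' p (diag_form q x) * (2 * q i)"
  unfolding partial_lyapunov_fun
  by (subst partial_eq_of_has_derivative[OF has_derivative_lyapunov_gradient])
    (simp add: power2_eq_square)

lemma bounded_above_if_nonpos_outside_ball:
  fixes F :: "'a::{heine_borel,real_normed_vector} \<Rightarrow> real"
  assumes "continuous_on UNIV F" and "\<forall>x. R \<le> norm x \<longrightarrow> F x \<le> 0"
  obtains B where "0 < B" and "\<forall>x. F x \<le> B"
proof -
  have "compact (F ` cball 0 R)"
    using assms(1) by (intro compact_continuous_image) (auto intro: continuous_on_subset)
  then obtain B where "0 < B" and B: "\<forall>y\<in>F ` cball 0 R. norm y \<le> B"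
    using compact_imp_bounded bounded_pos by metis
  have "F x \<le> B" for x
  proof (cases "norm x \<le> R")
    case True
    then show ?thesis using B by (auto dest: abs_le_D1)
  next
    case False
    then have "F x \<le> 0" using assms(2) by simp
    then show ?thesis using \<open>0 < B\<close> by simp
  qed
  with \<open>0 < B\<close> show ?thesis using that by blast
qed

lemma lyapunov_fun_eq_powr: "1 \<le> diag_form q x \<Longrightarrow> lyapunov_fun q p x = diag_form q x powr p"
  by (simp add: lyapunov_fun_def smooth_powr_def)

lemma lyapunov_drift_term_eq:
  assumes "1 \<le> diag_form q x"
  shows "(\<Sum>i\<in>UNIV. b $ i * partial i (lyapunov_fun q p) x)
    = 2 * p * diag_form q x powr (p - 1) * (\<Sum>i\<in>UNIV. q i * x $ i * b $ i)"
  using assms by (simp add: partial_lyapunov_fun smooth_powr'_def sum_distrib_left mult_ac)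

lemma lyapunov_diffusion_term_le:
  assumes q: "\<forall>i. 0 \<le> q i" and lam: "\<forall>i. 0 \<le> lam i" and p: "0 < p"
    and t: "1 \<le> diag_form q x"
  shows "(\<Sum>i\<in>UNIV. lam i * partial i (partial i (lyapunov_fun q p)) x)
    \<le> (4 * p * \<bar>p - 1\<bar> + 2 * p) * sum q UNIV * sum lam UNIV * diag_form q x powr (p - 1)"
proof -
  define t where "t = diag_form q x"
  define w where "w = t powr (p - 1)"
  have "0 < t" using assms unfolding t_def by simp
  have "t powr (p - 2 + 1) = t powr (p - 2) * t" using \<open>0 < t\<close> by (subst powr_add) simp
  then have w_eq: "t powr (p - 2) * t = w" unfolding w_def by simp
  have "partial i (partial i (lyapunov_fun q p)) x \<le> (4 * p * \<bar>p - 1\<bar> + 2 * p) * sum q UNIV * w" for i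
  proof -
    have q_le: "q i \<le> sum q UNIV" using q by (intro member_le_sum) auto
    have term_le: "q i * (x $ i)\<^sup>2 \<le> t"
      unfolding t_def diag_form_def using q by (intro member_le_sum[where f = "\<lambda>i. q i * (x $ i)\<^sup>2"]) auto
    have "(2 * q i * x $ i)\<^sup>2 \<le> 4 * sum q UNIV * t"
      using mult_mono[OF q_le term_le] q sum_nonneg[of UNIV q] by (simp add: power2_eq_square mult_ac)
    have "p * (p - 1) * t powr (p - 2) \<le> p * \<bar>p - 1\<bar> * t powr (p - 2)"
      using p by (intro mult_right_mono mult_left_mono) auto
    then have "p * (p - 1) * t powr (p - 2) * (2 * q i * x $ i)\<^sup>2
        \<le> p * \<bar>p - 1\<bar> * t powr (p - 2) * (2 * q i * x $ i)\<^sup>2"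
      by (rule mult_right_mono) simp
    also have "\<dots> \<le> p * \<bar>p - 1\<bar> * t powr (p - 2) * (4 * sum q UNIV * t)"
      by (rule mult_left_mono) (use \<open>(2 * q i * x $ i)\<^sup>2 \<le> 4 * sum q UNIV * t\<close> p in simp_all)
    also have "\<dots> = 4 * p * \<bar>p - 1\<bar> * sum q UNIV * w" using w_eq by (simp add: mult_ac)
    finally have "p * (p - 1) * t powr (p - 2) * (2 * q i * x $ i)\<^sup>2 \<le> 4 * p * \<bar>p - 1\<bar> * sum q UNIV * w" .
    moreover have "p * w * (2 * q i) \<le> 2 * p * sum q UNIV * w"
      using mult_right_mono[OF q_le, of w] p unfolding w_def by (simp add: mult_ac)
    ultimately show ?thesis
      using t unfolding partial2_lyapunov_fun t_def[symmetric] w_def smooth_powr'_def smooth_powr''_def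
      by (simp add: algebra_simps)
  qed
  then have "(\<Sum>i\<in>UNIV. lam i * partial i (partial i (lyapunov_fun q p)) x)
      \<le> (\<Sum>i\<in>UNIV. lam i * ((4 * p * \<bar>p - 1\<bar> + 2 * p) * sum q UNIV * w))"
    using lam by (intro sum_mono mult_left_mono) auto
  also have "\<dots> = (4 * p * \<bar>p - 1\<bar> + 2 * p) * sum q UNIV * sum lam UNIV * w"
    by (simp only: sum_distrib_right[symmetric]) (simp add: mult_ac)
  finally show ?thesis unfolding w_def t_def .
qed

lemma lyapunov_generator_far_bound:
  fixes bx :: "real^'n::finite"
  assumes q: "\<forall>i. 1 \<le> q i" and lam: "\<forall>i. 0 \<le> lam i" and p: "0 < p" and c: "0 < c"
    and x: "1 \<le> norm x"
    and dissipative: "(\<Sum>i\<in>UNIV. q i * x $ i * bx $ i) \<le> L * norm x - c * (norm x)\<^sup>2"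
  shows "(\<Sum>i\<in>UNIV. lam i * partial i (partial i (lyapunov_fun q p)) x)
      + (\<Sum>i\<in>UNIV. bx $ i * partial i (lyapunov_fun q p) x) + p * c / sum q UNIV * lyapunov_fun q p x
    \<le> diag_form q x powr (p - 1) * ((4 * p * \<bar>p - 1\<bar> + 2 * p) * sum q UNIV * sum lam UNIV
      + 2 * p * L * norm x - p * c * (norm x)\<^sup>2)"
proof -
  define t where "t = diag_form q x"
  define w where "w = t powr (p - 1)"
  have q_nonneg: "\<forall>i. 0 \<le> q i" using q by (meson order_trans zero_le_one)
  have "1 \<le> sum q UNIV" using q member_le_sum[of undefined UNIV q] q_nonneg by (meson UNIV_I order_trans finite)
  have "(norm x)\<^sup>2 \<le> t" unfolding t_def by (rule norm_square_le_diag_form[OF q])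
  then have "1 \<le> t" using one_le_power[OF x, of 2] by linarith
  then have "0 < w" unfolding w_def by simp
  have "(\<Sum>i\<in>UNIV. lam i * partial i (partial i (lyapunov_fun q p)) x)
      \<le> (4 * p * \<bar>p - 1\<bar> + 2 * p) * sum q UNIV * sum lam UNIV * w"
    using lyapunov_diffusion_term_le[OF q_nonneg lam p] \<open>1 \<le> t\<close> unfolding w_def t_def by simp
  moreover have "(\<Sum>i\<in>UNIV. bx $ i * partial i (lyapunov_fun q p) x) \<le> 2 * p * w * (L * norm x - c * (norm x)\<^sup>2)"
    using lyapunov_drift_term_eq[of q x bx p] \<open>1 \<le> t\<close> dissipative \<open>0 < w\<close> p
    unfolding w_def t_def by (simp add: mult_left_mono)
  moreover have "p * c / sum q UNIV * lyapunov_fun q p x \<le> p * c * (norm x)\<^sup>2 * w"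
  proof -
    have "t powr (p - 1 + 1) = w * t" using \<open>1 \<le> t\<close> unfolding w_def by (subst powr_add) simp
    then have "lyapunov_fun q p x = w * t"
      using lyapunov_fun_eq_powr[of q x p] \<open>1 \<le> t\<close> unfolding t_def by simp
    also have "\<dots> \<le> w * (sum q UNIV * (norm x)\<^sup>2)"
      using diag_form_le_norm_square[OF q_nonneg] \<open>0 < w\<close> unfolding t_def by (simp add: mult_left_mono)
    finally show ?thesis
      using c p \<open>1 \<le> sum q UNIV\<close> by (simp add: field_simps mult_left_mono)
  qed
  ultimately show ?thesis unfolding w_def t_def by (simp add: algebra_simps)
qed

lemma lyapunov_fun_foster_bound:
  fixes b :: "real^'n::finite \<Rightarrow> real^'n"
  assumes q: "\<forall>i. 1 \<le> q i" and lam: "\<forall>i. 0 \<le> lam i" and p: "0 < p" and c: "0 < c"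
    and b: "continuous_on UNIV b"
    and dissipative: "\<forall>x. (\<Sum>i\<in>UNIV. q i * x $ i * b x $ i) \<le> L * norm x - c * (norm x)\<^sup>2"
  obtains \<kappa>0 \<kappa>1 where "0 < \<kappa>0" and "0 < \<kappa>1"
    and "\<forall>x. (\<Sum>i\<in>UNIV. lam i * partial i (partial i (lyapunov_fun q p)) x)
           + (\<Sum>i\<in>UNIV. b x $ i * partial i (lyapunov_fun q p) x) \<le> \<kappa>0 - \<kappa>1 * lyapunov_fun q p x"
proof -
  let ?V = "lyapunov_fun q p"
  define F where "F x = (\<Sum>i\<in>UNIV. lam i * partial i (partial i ?V) x)
    + (\<Sum>i\<in>UNIV. b x $ i * partial i ?V x) + p * c / sum q UNIV * ?V x" for x
  define A where "A = (4 * p * \<bar>p - 1\<bar> + 2 * p) * sum q UNIV * sum lam UNIV"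
  define R where "R = max 1 ((A + 2 * p * \<bar>L\<bar>) / (p * c))"
  have "0 < sum q UNIV" using q by (intro sum_pos) (auto intro: less_le_trans[OF zero_less_one])
  have "0 \<le> A" unfolding A_def using p \<open>0 < sum q UNIV\<close> lam by (simp add: sum_nonneg)
  have "F x \<le> 0" if "R \<le> norm x" for x
  proof -
    have "1 \<le> norm x" using that unfolding R_def by simp
    have "A \<le> A * norm x" using mult_left_mono[OF \<open>1 \<le> norm x\<close> \<open>0 \<le> A\<close>] by simp
    moreover have "2 * p * (L * norm x) \<le> 2 * p * (\<bar>L\<bar> * norm x)"
      using p by (intro mult_left_mono mult_right_mono) auto
    moreover have "A + 2 * p * \<bar>L\<bar> \<le> p * c * norm x"
      using that p c unfolding R_def by (simp add: field_simps)
    then have "(A + 2 * p * \<bar>L\<bar>) * norm x \<le> p * c * norm x * norm x"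
      by (rule mult_right_mono) simp
    then have "(A + 2 * p * \<bar>L\<bar>) * norm x \<le> p * c * (norm x)\<^sup>2"
      by (simp add: power2_eq_square mult.assoc)
    ultimately have "A + 2 * p * L * norm x - p * c * (norm x)\<^sup>2 \<le> 0"
      by (simp add: algebra_simps)
    from mult_nonneg_nonpos[OF powr_ge_zero[of "diag_form q x" "p - 1"] this] show ?thesis
      using lyapunov_generator_far_bound[OF q lam p c \<open>1 \<le> norm x\<close> dissipative[rule_format, of x]]
      unfolding F_def A_def by linarith
  qed
  moreover have "continuous_on UNIV F"
    unfolding F_def partial2_lyapunov_fun unfolding partial_lyapunov_fun lyapunov_fun_def
    by (intro continuous_intros continuous_on_smooth_powr_diag_form continuous_on_component b)
  ultimately obtain B where "0 < B" and "\<forall>x. F x \<le> B"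
    using bounded_above_if_nonpos_outside_ball by blast
  moreover have "0 < p * c / sum q UNIV" using p c \<open>0 < sum q UNIV\<close> by simp
  ultimately show ?thesis using that unfolding F_def by (simp add: algebra_simps)
qed

lemma diag_lyapunov_function_exists:
  fixes b :: "real^'n::finite \<Rightarrow> real^'n"
  assumes q: "\<forall>i. 1 \<le> q i" and lam: "\<forall>i. 0 \<le> lam i" and m: "1 \<le> m" and c: "0 < c"
    and b: "continuous_on UNIV b"
    and dissipative: "\<forall>x. (\<Sum>i\<in>UNIV. q i * x $ i * b x $ i) \<le> L * norm x - c * (norm x)\<^sup>2"
  shows "\<exists>(Q :: real^'n^'n) (V :: real^'n \<Rightarrow> real) \<kappa>0 \<kappa>1.
    (\<forall>i j. i \<noteq> j \<longrightarrow> Q $ i $ j = 0) \<and> (\<forall>i. 0 < Q $ i $ i) \<and> C2 V \<and>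
    (\<forall>x. 1 \<le> norm x \<longrightarrow> V x = (x \<bullet> (Q *v x)) powr (m / 2)) \<and> 0 < \<kappa>0 \<and> 0 < \<kappa>1 \<and>
    (\<forall>x. (\<Sum>i\<in>UNIV. lam i * partial i (partial i V) x) + (\<Sum>i\<in>UNIV. b x $ i * partial i V x)
       \<le> \<kappa>0 - \<kappa>1 * V x)"
proof -
  define Q :: "real^'n^'n" where "Q = (\<chi> i j. if i = j then q i else 0)"
  have "0 < m / 2" using m by simp
  then obtain \<kappa>0 \<kappa>1 where "0 < \<kappa>0" "0 < \<kappa>1" and foster: "\<forall>x.
      (\<Sum>i\<in>UNIV. lam i * partial i (partial i (lyapunov_fun q (m / 2))) x)
      + (\<Sum>i\<in>UNIV. b x $ i * partial i (lyapunov_fun q (m / 2)) x)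
      \<le> \<kappa>0 - \<kappa>1 * lyapunov_fun q (m / 2) x"
    by (rule lyapunov_fun_foster_bound[OF q lam _ c b dissipative])
  have "1 \<le> diag_form q x" if "1 \<le> norm x" for x
    using one_le_power[OF that, of 2] norm_square_le_diag_form[OF q, of x] by simp
  then have "\<forall>x. 1 \<le> norm x \<longrightarrow> lyapunov_fun q (m / 2) x = (x \<bullet> (Q *v x)) powr (m / 2)"
    unfolding Q_def by (simp add: inner_diag_matrix lyapunov_fun_eq_powr)
  moreover have "\<forall>i j. i \<noteq> j \<longrightarrow> Q $ i $ j = 0" and "\<forall>i. 0 < Q $ i $ i"
    using q unfolding Q_def by (auto intro: less_le_trans[OF zero_less_one])
  ultimately show ?thesis using C2_lyapunov_fun foster \<open>0 < \<kappa>0\<close> \<open>0 < \<kappa>1\<close>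
    by (intro exI[of _ Q] exI[of _ "lyapunov_fun q (m / 2)"] exI[of _ \<kappa>0] exI[of _ \<kappa>1] conjI) simp_all
qed

section \<open>The network under the constant control\<close>

locale tree_network = rooted_bip_tree E root
  for E :: "'i::finite \<Rightarrow> 'j::finite \<Rightarrow> bool" and root :: 'j +
  fixes \<mu> :: "'i \<Rightarrow> 'j \<Rightarrow> real" and \<gamma> :: "'i \<Rightarrow> real" and k :: 'i
  assumes mu_pos: "\<And>i j. E i j \<Longrightarrow> 0 < \<mu> i j"
    and mu_zero: "\<And>i j. \<not> E i j \<Longrightarrow> \<mu> i j = 0"
    and gamma_k_pos: "0 < \<gamma> k"
    and edge_k_root: "E k root"
begin

definition ubar :: "('i \<Rightarrow> real) \<times> ('j \<Rightarrow> real)" where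
  "ubar = ((\<lambda>i. if i = k then 1 else 0), (\<lambda>j. if j = root then 1 else 0))"

lemma ubar_in_Uset: "ubar \<in> Uset"
  unfolding Uset_def ubar_def by auto

lemma depth_k: "depth (Inl k) = 1"
  using depth_adj_le[of "Inr root" "Inl k"] depth_Inl_pos[of k] edge_k_root by simp

lemma parent_pool_k: "parent_pool k = root"
  using parent_unique[of "Inr root" "Inl k"] edge_k_root depth_k parent_Inl[of k] by simp

definition class_alloc :: "real^'i \<Rightarrow> 'i \<Rightarrow> real" where
  "class_alloc x i = x $ i - ppart (esum x) * fst ubar i"

definition pool_alloc :: "real^'i \<Rightarrow> 'j \<Rightarrow> real" where
  "pool_alloc x j = - npart (esum x) * snd ubar j"

lemma Ghat_ubar: "Ghat E ubar x = tree_flow (class_alloc x) (pool_alloc x)"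
proof -
  have "sum (class_alloc x) UNIV = esum x - ppart (esum x)"
    unfolding class_alloc_def by (simp add: sum_subtractf esum_def ubar_def flip: sum_distrib_left)
  moreover have "sum (pool_alloc x) UNIV = - npart (esum x)"
    unfolding pool_alloc_def by (simp add: ubar_def sum_negf flip: sum_distrib_left)
  ultimately have "sum (class_alloc x) UNIV = sum (pool_alloc x) UNIV"
    unfolding ppart_def npart_def by simp
  moreover have "Ghat E ubar x = Gmat E (class_alloc x) (pool_alloc x)"
    unfolding Ghat_def class_alloc_def[abs_def] pool_alloc_def[abs_def] by simp
  ultimately show ?thesis using Gmat_eq_tree_flow by simp
qed

definition departure_rate :: "real^'i \<Rightarrow> 'i \<Rightarrow> real" where
  "departure_rate x i = (\<Sum>j\<in>UNIV. \<mu> i j * Ghat E ubar x i j) + \<gamma> i * ppart (esum x) * fst ubar i"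

lemma drift_ubar: "drift E \<mu> \<gamma> ell x ubar = (\<chi> i. ell i - departure_rate x i)"
proof -
  have "(\<Sum>j\<in>{j. E i j}. \<mu> i j * Ghat E ubar x i j) = (\<Sum>j\<in>UNIV. \<mu> i j * Ghat E ubar x i j)" for i
    using mu_zero by (intro sum.mono_neutral_left) auto
  then show ?thesis unfolding drift_def departure_rate_def by (simp add: vec_eq_iff)
qed

definition subtree_mass :: "real^'i \<Rightarrow> 'j \<Rightarrow> real" where
  "subtree_mass x j = (\<Sum>i | Inl i \<in> subtree (Inr j). x $ i)"

lemma subtree_sum_child_pool:
  assumes "j \<in> child_pools i"
  shows "subtree_sum (flow_weight (class_alloc x) (pool_alloc x)) (Inr j) = subtree_mass x j"
proof -
  have "2 \<le> depth (Inr j)" using depth_child_pool[OF assms] depth_Inl_pos[of i] by simp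
  then have "Inl k \<notin> subtree (Inr j)" "Inr root \<notin> subtree (Inr j)"
    using depth_subtree depth_k by fastforce+
  then have "flow_weight (class_alloc x) (pool_alloc x) u = (case u of Inl i \<Rightarrow> x $ i | Inr _ \<Rightarrow> 0)"
    if "u \<in> subtree (Inr j)" for u
    using that by (cases u) (auto simp: flow_weight_def class_alloc_def pool_alloc_def ubar_def)
  then have "subtree_sum (flow_weight (class_alloc x) (pool_alloc x)) (Inr j)
      = (\<Sum>u\<in>UNIV. if u \<in> subtree (Inr j) then case u of Inl i \<Rightarrow> x $ i | Inr _ \<Rightarrow> 0 else 0)"
    unfolding subtree_sum_def by (simp add: sum.If_cases)
  also have "\<dots> = subtree_mass x j"
    unfolding sum_UNIV_sum_type subtree_mass_def by (simp add: sum.If_cases)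
  finally show ?thesis .
qed

lemma departure_rate_eq:
  "departure_rate x i = \<mu> i (parent_pool i) * class_alloc x i
     + (\<Sum>j\<in>child_pools i. (\<mu> i (parent_pool i) - \<mu> i j) * subtree_mass x j)
     + \<gamma> i * ppart (esum x) * fst ubar i"
proof -
  let ?S = "subtree_sum (flow_weight (class_alloc x) (pool_alloc x))"
  have "(\<Sum>j\<in>UNIV. \<mu> i j * Ghat E ubar x i j)
      = \<mu> i (parent_pool i) * ?S (Inl i) - (\<Sum>j\<in>child_pools i. \<mu> i j * ?S (Inr j))"
    unfolding Ghat_ubar by (rule tree_flow_weighted_row_sum)
  also have "?S (Inl i) = class_alloc x i + (\<Sum>j\<in>child_pools i. subtree_mass x j)"
    using subtree_sum_Inl[of _ i] subtree_sum_child_pool by (simp add: flow_weight_def)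
  finally show ?thesis
    using subtree_sum_child_pool unfolding departure_rate_def
    by (simp add: algebra_simps sum_distrib_left sum_subtractf)
qed

text \<open>Through the total e\<bullet>x the row of k is coupled to every other class, so k is ranked
  first; the remaining classes are ranked by depth, which puts every subtree below its root.\<close>
definition rank :: "'i \<Rightarrow> nat" where
  "rank i = (if i = k then 0 else depth (Inl i))"

definition higher_rank_mass :: "real^'i \<Rightarrow> 'i \<Rightarrow> real" where
  "higher_rank_mass x i = (\<Sum>i' | rank i < rank i'. \<bar>x $ i'\<bar>)"

lemma higher_rank_mass_nonneg: "0 \<le> higher_rank_mass x i"
  unfolding higher_rank_mass_def by (simp add: sum_nonneg)

lemma abs_sum_le_higher_rank_mass:
  assumes "\<And>i'. i' \<in> A \<Longrightarrow> rank i < rank i'"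
  shows "\<bar>\<Sum>i'\<in>A. x $ i'\<bar> \<le> higher_rank_mass x i"
proof -
  have "\<bar>\<Sum>i'\<in>A. x $ i'\<bar> \<le> (\<Sum>i'\<in>A. \<bar>x $ i'\<bar>)" by (rule sum_abs)
  also have "\<dots> \<le> higher_rank_mass x i"
    unfolding higher_rank_mass_def using assms by (intro sum_mono2) auto
  finally show ?thesis .
qed

lemma abs_subtree_mass_le: "j \<in> child_pools i \<Longrightarrow> \<bar>subtree_mass x j\<bar> \<le> higher_rank_mass x i"
  unfolding subtree_mass_def
proof (rule abs_sum_le_higher_rank_mass)
  fix i' assume j: "j \<in> child_pools i" and "i' \<in> {i'. Inl i' \<in> subtree (Inr j)}"
  then have "depth (Inl i) + 1 \<le> depth (Inl i')"
    using depth_subtree depth_child_pool by fastforce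
  then show "rank i < rank i'" using depth_k depth_Inl_pos[of i] unfolding rank_def by auto
qed

lemma abs_sum_others_le_higher_rank_mass: "\<bar>\<Sum>i\<in>UNIV - {k}. x $ i\<bar> \<le> higher_rank_mass x k"
  by (rule abs_sum_le_higher_rank_mass) (use depth_Inl_pos in \<open>auto simp: rank_def\<close>)

definition coercivity :: real where
  "coercivity = min (\<gamma> k) (Min (range (\<lambda>i. \<mu> i (parent_pool i))))"

definition coupling :: real where
  "coupling = (\<Sum>i\<in>UNIV. \<Sum>j\<in>child_pools i. \<bar>\<mu> i (parent_pool i) - \<mu> i j\<bar>) + \<bar>\<gamma> k - \<mu> k root\<bar>"

lemma coercivity_pos: "0 < coercivity"
  using gamma_k_pos mu_pos[OF edge_parent_pool] unfolding coercivity_def by (simp add: Min_gr_iff)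

lemma coercivity_le: "coercivity \<le> \<gamma> k" "coercivity \<le> \<mu> i (parent_pool i)"
  unfolding coercivity_def by (auto intro: min.coboundedI2)

lemma child_term_bound:
  "\<bar>\<Sum>j\<in>child_pools i. (\<mu> i (parent_pool i) - \<mu> i j) * subtree_mass x j\<bar>
     \<le> (\<Sum>j\<in>child_pools i. \<bar>\<mu> i (parent_pool i) - \<mu> i j\<bar>) * higher_rank_mass x i"
proof -
  have "\<bar>\<Sum>j\<in>child_pools i. (\<mu> i (parent_pool i) - \<mu> i j) * subtree_mass x j\<bar>
      \<le> (\<Sum>j\<in>child_pools i. \<bar>\<mu> i (parent_pool i) - \<mu> i j\<bar> * \<bar>subtree_mass x j\<bar>)"
    by (rule order_trans[OF sum_abs]) (simp add: abs_mult)
  also have "\<dots> \<le> (\<Sum>j\<in>child_pools i. \<bar>\<mu> i (parent_pool i) - \<mu> i j\<bar> * higher_rank_mass x i)"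
    using abs_subtree_mass_le by (intro sum_mono mult_left_mono) auto
  finally show ?thesis by (simp add: sum_distrib_right)
qed

text \<open>At the class k, where excess work is queued, abandonment at rate \<gamma> k replaces
  service at rate \<mu> k root; the exchange only couples x k to the other classes.\<close>
lemma principal_term_lower_bound:
  "coercivity * (x $ i)\<^sup>2 - \<bar>\<gamma> k - \<mu> k root\<bar> * \<bar>x $ i\<bar> * higher_rank_mass x i
     \<le> x $ i * (\<mu> i (parent_pool i) * class_alloc x i + \<gamma> i * ppart (esum x) * fst ubar i)"
proof (cases "i = k")
  case False
  have "coercivity * (x $ i)\<^sup>2 \<le> \<mu> i (parent_pool i) * (x $ i)\<^sup>2"
    using coercivity_le(2) by (rule mult_right_mono) simp
  moreover have "0 \<le> \<bar>\<gamma> k - \<mu> k root\<bar> * \<bar>x $ i\<bar> * higher_rank_mass x i"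
    using higher_rank_mass_nonneg by simp
  ultimately show ?thesis
    using False by (simp add: class_alloc_def ubar_def power2_eq_square algebra_simps)
next
  case True
  define Z where "Z = (\<Sum>i\<in>UNIV - {k}. x $ i)"
  have esum: "esum x = x $ k + Z" unfolding esum_def Z_def by (simp add: sum.remove)
  have Z_bound: "x $ k * ((\<gamma> k - \<mu> k root) * Z) \<ge> - (\<bar>\<gamma> k - \<mu> k root\<bar> * \<bar>x $ k\<bar> * higher_rank_mass x k)"
  proof -
    have "\<bar>x $ k\<bar> * (\<bar>\<gamma> k - \<mu> k root\<bar> * \<bar>Z\<bar>) \<le> \<bar>x $ k\<bar> * (\<bar>\<gamma> k - \<mu> k root\<bar> * higher_rank_mass x k)"
      using abs_sum_others_le_higher_rank_mass[of x] unfolding Z_def by (intro mult_left_mono) auto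
    then have "\<bar>x $ k * ((\<gamma> k - \<mu> k root) * Z)\<bar> \<le> \<bar>\<gamma> k - \<mu> k root\<bar> * \<bar>x $ k\<bar> * higher_rank_mass x k"
      by (simp add: abs_mult mult_ac)
    then show ?thesis by linarith
  qed
  show ?thesis
  proof (cases "0 \<le> esum x")
    case nonneg: True
    then have "x $ k * (\<mu> k root * class_alloc x k + \<gamma> k * ppart (esum x) * fst ubar k)
        = \<gamma> k * (x $ k)\<^sup>2 + x $ k * ((\<gamma> k - \<mu> k root) * Z)"
      unfolding class_alloc_def ppart_def ubar_def esum by (simp add: power2_eq_square algebra_simps)
    moreover have "coercivity * (x $ k)\<^sup>2 \<le> \<gamma> k * (x $ k)\<^sup>2"
      using coercivity_le(1) by (rule mult_right_mono) simp
    ultimately show ?thesis using True Z_bound parent_pool_k by simp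
  next
    case False
    then have "x $ k * (\<mu> k root * class_alloc x k + \<gamma> k * ppart (esum x) * fst ubar k)
        = \<mu> k root * (x $ k)\<^sup>2"
      unfolding class_alloc_def ppart_def ubar_def by (simp add: power2_eq_square)
    moreover have "coercivity * (x $ k)\<^sup>2 \<le> \<mu> k root * (x $ k)\<^sup>2"
      using coercivity_le(2)[of k] parent_pool_k by (intro mult_right_mono) simp_all
    moreover have "0 \<le> \<bar>\<gamma> k - \<mu> k root\<bar> * \<bar>x $ k\<bar> * higher_rank_mass x k"
      using higher_rank_mass_nonneg by simp
    ultimately show ?thesis using True parent_pool_k by simp
  qed
qed

lemma departure_rate_lower_bound:
  "coercivity * (x $ i)\<^sup>2 - coupling * \<bar>x $ i\<bar> * higher_rank_mass x i \<le> x $ i * departure_rate x i"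
proof -
  define C where "C = (\<Sum>j\<in>child_pools i. \<bar>\<mu> i (parent_pool i) - \<mu> i j\<bar>)"
  define R where "R = (\<Sum>j\<in>child_pools i. (\<mu> i (parent_pool i) - \<mu> i j) * subtree_mass x j)"
  have "\<bar>x $ i * R\<bar> \<le> \<bar>x $ i\<bar> * (C * higher_rank_mass x i)"
    using child_term_bound unfolding R_def C_def by (simp add: abs_mult mult_left_mono)
  then have "- (C * \<bar>x $ i\<bar> * higher_rank_mass x i) \<le> x $ i * R" by (simp add: mult_ac)
  moreover have "C + \<bar>\<gamma> k - \<mu> k root\<bar> \<le> coupling"
    unfolding C_def coupling_def
    by (intro add_right_mono member_le_sum[where f = "\<lambda>i. \<Sum>j\<in>child_pools i. _ i j"]) (auto simp: sum_nonneg)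
  then have "(C + \<bar>\<gamma> k - \<mu> k root\<bar>) * (\<bar>x $ i\<bar> * higher_rank_mass x i) \<le> coupling * (\<bar>x $ i\<bar> * higher_rank_mass x i)"
    using higher_rank_mass_nonneg by (intro mult_right_mono) auto
  ultimately show ?thesis
    using principal_term_lower_bound[of x i] unfolding departure_rate_eq R_def[symmetric]
    by (simp add: algebra_simps)
qed

lemma departure_rate_coercive:
  obtains q :: "'i \<Rightarrow> real" where "\<forall>i. 1 \<le> q i"
    and "\<And>x. coercivity / 4 * (norm x)\<^sup>2 \<le> (\<Sum>i\<in>UNIV. q i * (x $ i * departure_rate x i))"
proof -
  obtain q :: "'i \<Rightarrow> real" where q: "\<forall>i. 1 \<le> q i"
    and weights: "\<And>y m. (\<And>i. coercivity * (y i)\<^sup>2 - coupling * \<bar>y i\<bar> * (\<Sum>i' | rank i < rank i'. \<bar>y i'\<bar>)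
        \<le> y i * m i) \<Longrightarrow> coercivity / 4 * (\<Sum>i\<in>UNIV. (y i)\<^sup>2) \<le> (\<Sum>i\<in>UNIV. q i * (y i * m i))"
    using triangular_coercive_weights[OF coercivity_pos] by blast
  have "(norm x)\<^sup>2 = (\<Sum>i\<in>UNIV. (x $ i)\<^sup>2)" for x :: "real^'i"
    by (simp only: power2_norm_eq_inner inner_vec_def) (simp add: power2_eq_square)
  then have "coercivity / 4 * (norm x)\<^sup>2 \<le> (\<Sum>i\<in>UNIV. q i * (x $ i * departure_rate x i))" for x
    using weights[of "\<lambda>i. x $ i" "departure_rate x"] departure_rate_lower_bound
    unfolding higher_rank_mass_def by simp
  with q show ?thesis using that by blast
qed

lemma drift_ubar_dissipative:
  obtains q :: "'i \<Rightarrow> real" and c L :: real where "\<forall>i. 1 \<le> q i" and "0 < c"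
    and "\<forall>x. (\<Sum>i\<in>UNIV. q i * x $ i * drift E \<mu> \<gamma> ell x ubar $ i) \<le> L * norm x - c * (norm x)\<^sup>2"
proof -
  obtain q where q: "\<forall>i. 1 \<le> q i"
    and coercive: "\<And>x. coercivity / 4 * (norm x)\<^sup>2 \<le> (\<Sum>i\<in>UNIV. q i * (x $ i * departure_rate x i))"
    using departure_rate_coercive by blast
  define L where "L = (\<Sum>i\<in>UNIV. q i * \<bar>ell i\<bar>)"
  have ell_bound: "(\<Sum>i\<in>UNIV. q i * x $ i * ell i) \<le> L * norm x" for x
  proof -
    have "q i * x $ i * ell i \<le> q i * \<bar>ell i\<bar> * norm x" for i
    proof -
      have "x $ i * ell i \<le> \<bar>ell i\<bar> * \<bar>x $ i\<bar>"
        by (metis abs_ge_self abs_mult mult.commute)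
      then have "q i * x $ i * ell i \<le> q i * (\<bar>ell i\<bar> * \<bar>x $ i\<bar>)"
        using q[rule_format, of i] by (simp add: mult.assoc mult_left_mono)
      also have "\<dots> \<le> q i * (\<bar>ell i\<bar> * norm x)"
        using q[rule_format, of i] component_le_norm_cart[of x i] by (intro mult_left_mono) auto
      finally show ?thesis by (simp add: mult_ac)
    qed
    then show ?thesis unfolding L_def sum_distrib_right by (rule sum_mono)
  qed
  have drift_eq: "(\<Sum>i\<in>UNIV. q i * x $ i * drift E \<mu> \<gamma> ell x ubar $ i)
      = (\<Sum>i\<in>UNIV. q i * x $ i * ell i) - (\<Sum>i\<in>UNIV. q i * (x $ i * departure_rate x i))" for x
    by (simp add: drift_ubar right_diff_distrib sum_subtractf mult_ac)
  have "(\<Sum>i\<in>UNIV. q i * x $ i * drift E \<mu> \<gamma> ell x ubar $ i) \<le> L * norm x - coercivity / 4 * (norm x)\<^sup>2"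
    for x using coercive[of x] ell_bound[of x] drift_eq[of x] by linarith
  then show ?thesis by (intro that[OF q, of "coercivity / 4" L]) (use coercivity_pos in simp_all)
qed

lemma continuous_on_drift_ubar: "continuous_on UNIV (\<lambda>x. drift E \<mu> \<gamma> ell x ubar)"
proof -
  have "continuous_on UNIV (\<lambda>x. departure_rate x i)" for i
    unfolding departure_rate_eq class_alloc_def subtree_mass_def ppart_def esum_def
    by (intro continuous_intros)
  then show ?thesis unfolding drift_ubar by (intro continuous_on_vec_lambda continuous_intros)
qed

end

theorem mainTheorem7:
  fixes E :: "'i::finite \<Rightarrow> 'j::finite \<Rightarrow> bool"
    and \<mu> :: "'i \<Rightarrow> 'j \<Rightarrow> real"
    and lam \<gamma> ell :: "'i \<Rightarrow> real"
  assumes tree: "bip_tree E"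
    and lam_pos: "\<forall>i. 0 < lam i"
    and gam_nonneg: "\<forall>i. 0 \<le> \<gamma> i"
    and mu_pos: "\<forall>i j. E i j \<longrightarrow> 0 < \<mu> i j"
    and mu_zero: "\<forall>i j. \<not> E i j \<longrightarrow> \<mu> i j = 0"
    and gam_nonzero: "\<exists>i. \<gamma> i \<noteq> 0"
  shows "\<exists>ubar \<in> Uset. \<forall>m::real. 1 \<le> m \<longrightarrow>
           (\<exists>(Q :: real^'i^'i) (V :: real^'i \<Rightarrow> real) \<kappa>0 \<kappa>1.
              (\<forall>i j. i \<noteq> j \<longrightarrow> Q $ i $ j = 0) \<and> (\<forall>i. 0 < Q $ i $ i) \<and>
              C2 V \<and>
              (\<forall>x. 1 \<le> norm x \<longrightarrow> V x = (x \<bullet> (Q *v x)) powr (m / 2)) \<and>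
              0 < \<kappa>0 \<and> 0 < \<kappa>1 \<and>
              (\<forall>x. generator E \<mu> lam \<gamma> ell ubar V x \<le> \<kappa>0 - \<kappa>1 * V x))"
proof -
  obtain k where "\<gamma> k \<noteq> 0" using gam_nonzero by blast
  then have "0 < \<gamma> k" using gam_nonneg by (simp add: less_le)
  obtain root where "E k root" using bip_tree_has_neighbour[OF tree] by blast
  interpret tree_network E root \<mu> \<gamma> k
    by unfold_locales (use tree mu_pos mu_zero \<open>0 < \<gamma> k\<close> \<open>E k root\<close> in auto)
  obtain q c L where q: "\<forall>i. 1 \<le> q i" and c: "0 < c"
    and dissipative: "\<forall>x. (\<Sum>i\<in>UNIV. q i * x $ i * drift E \<mu> \<gamma> ell x ubar $ i) \<le> L * norm x - c * (norm x)\<^sup>2"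
    by (rule drift_ubar_dissipative)
  have "\<forall>i. 0 \<le> lam i" using lam_pos by (simp add: less_imp_le)
  from diag_lyapunov_function_exists[OF q this _ c continuous_on_drift_ubar dissipative]
  show ?thesis unfolding generator_def using ubar_in_Uset by blast
qed

end
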